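(* Let $\Delta$ be a positive integer. If a rank-$r$ matroid $M \in \mathcal{M}_{\Delta}$ has a set $X \subseteq E(M)$ such that $M|X \cong M(K_{r+1})$, then every element of $M$ is spanned by a set of at most $\Delta$ elements of $X$.
   Context: For a positive integer $\Delta$, an integer matrix $\mathbf{A}$ is $\Delta$-modular if the determinant of each $\operatorname{rank}(\mathbf{A}) \times \operatorname{rank}(\mathbf{A})$ submatrix of $\mathbf{A}$ has absolute value at most $\Delta$. $\mathcal{M}_{\Delta}$ denotes the set of $\Delta$-modular matroids, i.e. the matroids that have a representation over $\mathbb{R}$ as a $\Delta$-modular (integer) matrix (the ground set indexes the columns, and the rank of a set of elements is the rank of the corresponding set of columns). $M|X$ is the restriction of $M$ to $X$, and $M(K_n)$ is the graphic matroid of the complete graph on $n$ vertices. A set $Y \subseteq E(M)$ spans an element $t$ if $Y$ and $Y \cup \{t\}$ have the same rank in $M$. *)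

theory Defs
  imports "Jordan_Normal_Form.DL_Rank_Submatrix"
begin

section \<open>Matroids\<close>

record 'a set_system =
  ground :: "'a set"
  indep :: "'a set set"

locale matroid =
  fixes M :: "'a set_system"
  assumes finite_ground: "finite (ground M)"
    and indep_subset: "I \<in> indep M \<Longrightarrow> I \<subseteq> ground M"
    and indep_empty: "{} \<in> indep M"
    and indep_hereditary: "I \<in> indep M \<Longrightarrow> J \<subseteq> I \<Longrightarrow> J \<in> indep M"
    and indep_augment: "I \<in> indep M \<Longrightarrow> J \<in> indep M \<Longrightarrow> card J < card I \<Longrightarrow>
          \<exists>x \<in> I - J. insert x J \<in> indep M"

definition rank_of :: "'a set_system \<Rightarrow> 'a set \<Rightarrow> nat" where
  "rank_of M X = Max (card ` {I \<in> indep M. I \<subseteq> X})"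

definition matroid_rank :: "'a set_system \<Rightarrow> nat" where
  "matroid_rank M = rank_of M (ground M)"

definition restriction :: "'a set_system \<Rightarrow> 'a set \<Rightarrow> 'a set_system" where
  "restriction M X = \<lparr>ground = X, indep = {I \<in> indep M. I \<subseteq> X}\<rparr>"

definition matroid_iso :: "'a set_system \<Rightarrow> 'b set_system \<Rightarrow> bool" (infix "\<simeq>\<^sub>M" 50) where
  "M \<simeq>\<^sub>M N \<longleftrightarrow> (\<exists>f. bij_betw f (ground M) (ground N) \<and>
     (\<forall>I \<subseteq> ground M. I \<in> indep M \<longleftrightarrow> f ` I \<in> indep N))"

definition spans :: "'a set_system \<Rightarrow> 'a set \<Rightarrow> 'a \<Rightarrow> bool" where
  "spans M Y t \<longleftrightarrow> rank_of M Y = rank_of M (insert t Y)"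

section \<open>Graphic matroids\<close>

text \<open>A simple graph is given by its set of edges, each edge being a two-element set of vertices.
  A cycle is given by the list of its vertices in cyclic order.\<close>

definition is_cycle :: "'v set set \<Rightarrow> 'v list \<Rightarrow> bool" where
  "is_cycle F vs \<longleftrightarrow> 3 \<le> length vs \<and> distinct vs \<and>
     (\<forall>i < length vs. {vs ! i, vs ! (Suc i mod length vs)} \<in> F)"

definition graphic_matroid :: "'v set set \<Rightarrow> 'v set set_system" where
  "graphic_matroid F = \<lparr>ground = F, indep = {I. I \<subseteq> F \<and> (\<nexists>vs. is_cycle I vs)}\<rparr>"

definition complete_graph :: "nat \<Rightarrow> nat set set" where
  "complete_graph n = {e. e \<subseteq> {..<n} \<and> card e = 2}"

section \<open>\<open>\<Delta>\<close>-modular matrices and matroids\<close>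

definition real_rank :: "int mat \<Rightarrow> nat" where
  "real_rank A = vec_space.rank (dim_row A) (map_mat real_of_int A)"

definition modular_matrix :: "nat \<Rightarrow> int mat \<Rightarrow> bool" where
  "modular_matrix \<Delta> A \<longleftrightarrow> (\<forall>I \<subseteq> {..<dim_row A}. \<forall>J \<subseteq> {..<dim_col A}.
     card I = real_rank A \<longrightarrow> card J = real_rank A \<longrightarrow>
     \<bar>det (submatrix A I J)\<bar> \<le> int \<Delta>)"

text \<open>The function \<open>f\<close> labels the columns by the elements of the matroid; \<open>submatrix A UNIV J\<close>
  keeps all rows.\<close>

definition represents :: "int mat \<Rightarrow> 'a set_system \<Rightarrow> bool" where
  "represents A M \<longleftrightarrow> (\<exists>f. bij_betw f (ground M) {..<dim_col A} \<and>
     (\<forall>X \<subseteq> ground M. rank_of M X = real_rank (submatrix A UNIV (f ` X))))"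

definition modular_matroids :: "nat \<Rightarrow> 'a set_system set" where
  "modular_matroids \<Delta> = {M. matroid M \<and> (\<exists>A. modular_matrix \<Delta> A \<and> represents A M)}"

end

theory Submission
  imports Defs
begin

text \<open>
  Over the reals the matroid of a complete graph has only one representation, up to a change of basis
  and a rescaling of the columns (\<open>complete_graph_representation_unique\<close>). Hence, if \<open>V\<close> is the set of
  the \<open>r + 1\<close> vertices, the column of an edge \<open>xy\<close> is a multiple, of absolute value \<open>lam x y\<close> say, of
  the difference of the unit vectors at \<open>x\<close> and \<open>y\<close>, and every further element \<open>t\<close> becomes a function
  \<open>v\<close> on \<open>V\<close> with sum zero. A set of edges spans \<open>t\<close> iff \<open>v\<close> is a combination of the corresponding
  differences, so the task is to write \<open>v\<close> with at most \<open>\<Delta>\<close> edges. In these coordinates the maximal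
  minors can be computed: for a constant \<open>D\<close>, the minor at a spanning tree has absolute value \<open>D\<close> times
  the product of the weights \<open>lam\<close> along the tree, and the minor at \<open>t\<close>, a spanning tree of \<open>S\<close> and a
  spanning tree of \<open>V - S\<close> has in addition the factor \<open>sum v S\<close>. All these numbers are integers of
  absolute value at most \<open>\<Delta>\<close> (\<open>edge_span_of_minors\<close>).

  Suppose first that all weights are equal. Then a multiple \<open>z\<close> of \<open>v\<close> is integral and all its partial
  sums are at most \<open>\<Delta>\<close>. In particular so is the total mass of the positive entries of \<open>z\<close>, and
  moving this mass to the negative entries one unit at a time takes at most \<open>\<Delta>\<close> edges
  (\<open>edge_span_flow\<close>).

  In general the weights are almost equal. If \<open>\<Delta> \<ge> r\<close>, then any spanning tree has few enough edges.
  Otherwise, each vertex that can be attached to a growing tree by two edges of different weight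
  doubles a lower bound for the largest minor (\<open>tree_gain_exchange\<close>), so there are at most
  \<open>log 2 \<Delta>\<close> of them. It follows that all edges at some two vertices have the same weight \<open>c\<close>, and that
  at most \<open>\<Delta>\<close> vertices are incident with an edge of weight other than \<open>c\<close> (\<open>regular_vertices\<close>). The
  argument for equal weights goes through unless one side of the cut, say the positive one, has no
  vertex of the first kind and contains an edge \<open>xx'\<close> of weight other than \<open>c\<close>. In that case write
  \<open>lam x x' / c\<close> as a reduced fraction \<open>a / b\<close>. If \<open>b = 1\<close>, then trees through \<open>xx'\<close> give minors that
  are at least twice as large as those available before; if \<open>b > 1\<close>, then the integrality of these
  minors makes the entries of \<open>z\<close> multiples of \<open>b\<close> once \<open>x\<close> and \<open>x'\<close> are merged, so that the mass can
  be moved in portions of size \<open>b\<close> (\<open>edge_span_exceptional_edge\<close>).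
\<close>

section \<open>Zero-sum vectors as combinations of few edges\<close>

text \<open>The column of an oriented edge in the incidence matrix of a graph.\<close>

definition edge_vec :: "'v \<Rightarrow> 'v \<Rightarrow> 'v \<Rightarrow> real" where
  "edge_vec x y u = (if u = x then 1 else 0) - (if u = y then 1 else 0)"

text \<open>The edges of a combination of at most \<open>k\<close> edges are added one at a time. They may repeat, and they may
  be loops, which contribute zero; so adding two combinations needs no case distinction.\<close>

inductive edge_span :: "'v set \<Rightarrow> nat \<Rightarrow> ('v \<Rightarrow> real) \<Rightarrow> bool" for V where
  zero: "edge_span V k (\<lambda>_. 0)"
| step: "edge_span V k v \<Longrightarrow> x \<in> V \<Longrightarrow> y \<in> V \<Longrightarrow> edge_span V (Suc k) (\<lambda>u. v u + a * edge_vec x y u)"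

lemma edge_span_mono: "edge_span V k v \<Longrightarrow> k \<le> l \<Longrightarrow> edge_span V l v"
proof (induction arbitrary: l rule: edge_span.induct)
  case (step k v x y a)
  then obtain l' where "l = Suc l'" "k \<le> l'" by (cases l) auto
  then show ?case using step edge_span.step by metis
qed (rule edge_span.zero)

lemma edge_span_scale: "edge_span V k v \<Longrightarrow> edge_span V k (\<lambda>u. b * v u)"
proof (induction rule: edge_span.induct)
  case (step k v x y a)
  show ?case using edge_span.step[OF step.IH step.hyps(2,3), of "b * a"]
    by (simp add: algebra_simps)
qed (simp add: edge_span.zero)

lemma edge_span_star:
  assumes "finite V" "p \<in> V" "sum v V = 0" "\<And>u. u \<notin> V \<Longrightarrow> v u = 0"
  shows "edge_span V (card V - 1) v"
proof -
  have "edge_span V (card S) (\<lambda>u. \<Sum>x\<in>S. v x * edge_vec x p u)" if "S \<subseteq> V" for S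
    using finite_subset[OF that assms(1)] that
  proof (induction S rule: finite_induct)
    case (insert x S)
    have "edge_span V (Suc (card S)) (\<lambda>u. (\<Sum>x\<in>S. v x * edge_vec x p u) + v x * edge_vec x p u)"
      using insert assms by (intro step) auto
    then show ?case using insert by (simp add: add.commute)
  qed (simp add: zero)
  from this[of "V - {p}"] have "edge_span V (card V - 1) (\<lambda>u. \<Sum>x\<in>V-{p}. v x * edge_vec x p u)"
    using assms by simp
  moreover have "(\<Sum>x\<in>V-{p}. v x * edge_vec x p u) = v u" for u
  proof (cases "u = p")
    case True
    have "(\<Sum>x\<in>V-{p}. v x * edge_vec x p u) = (\<Sum>x\<in>V-{p}. - v x)"
      using True by (intro sum.cong) (auto simp: edge_vec_def)
    also have "\<dots> = v p" using sum.remove[OF assms(1,2), of v] assms(3) by (simp add: sum_negf)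
    finally show ?thesis using True by simp
  next
    case False
    have "(\<Sum>x\<in>V-{p}. v x * edge_vec x p u) = (\<Sum>x\<in>V-{p}. if x = u then v x else 0)"
      using False by (intro sum.cong) (auto simp: edge_vec_def)
    also have "\<dots> = v u" using False assms by (simp add: sum.delta')
    finally show ?thesis .
  qed
  ultimately show ?thesis by simp
qed

text \<open>If \<open>z\<close> has sum zero, this is the amount that must be moved from the positive to the negative entries.\<close>

definition pos_mass :: "'v set \<Rightarrow> ('v \<Rightarrow> int) \<Rightarrow> int" where
  "pos_mass V z = (\<Sum>x\<in>V. max 0 (z x))"

lemma pos_mass_update:
  assumes "finite V" "x \<in> V" "y \<in> V" "x \<noteq> y"
  shows "pos_mass V (z(x := a, y := b)) = pos_mass V z - max 0 (z x) - max 0 (z y) + max 0 a + max 0 b"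
proof -
  let ?z = "z(x := a, y := b)"
  have V: "V = insert x (insert y (V - {x, y}))" using assms by auto
  have "pos_mass V ?z = max 0 a + max 0 b + (\<Sum>u\<in>V-{x,y}. max 0 (?z u))"
    unfolding pos_mass_def by (subst V) (use assms in simp)
  moreover have "pos_mass V z = max 0 (z x) + max 0 (z y) + (\<Sum>u\<in>V-{x,y}. max 0 (z u))"
    unfolding pos_mass_def by (subst V) (use assms in simp)
  moreover have "(\<Sum>u\<in>V-{x,y}. max 0 (?z u)) = (\<Sum>u\<in>V-{x,y}. max 0 (z u))"
    by (intro sum.cong) auto
  ultimately show ?thesis by simp
qed

lemma edge_span_transfer:
  assumes "edge_span V k (\<lambda>u. real_of_int ((z(x := z x - b, y := z y + b)) u))" "x \<in> V" "y \<in> V" "x \<noteq> y"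
  shows "edge_span V (Suc k) (\<lambda>u. real_of_int (z u))"
proof -
  have "(\<lambda>u. real_of_int (z u)) = (\<lambda>u. real_of_int ((z(x := z x - b, y := z y + b)) u)
          + real_of_int b * edge_vec x y u)"
    using assms by (auto simp: edge_vec_def)
  then show ?thesis using step[OF assms(1,2,3), of "real_of_int b"] by simp
qed

lemma sum_transfer:
  fixes z :: "'v \<Rightarrow> int"
  assumes "finite V" "x \<in> V" "y \<in> V" "x \<noteq> y"
  shows "sum (z(x := z x - b, y := z y + b)) V = sum z V"
proof -
  have V: "V = insert x (insert y (V - {x, y}))" using assms by auto
  have "sum (z(x := z x - b, y := z y + b)) (V-{x,y}) = sum z (V-{x,y})"
    by (intro sum.cong) auto
  then show ?thesis
    by (subst (1 2) V) (use assms in \<open>simp del: fun_upd_apply\<close>, simp)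
qed

text \<open>Some entry is at least \<open>b\<close> and some entry at most \<open>- b\<close> unless \<open>z\<close> vanishes, and an edge between two
  such vertices carries \<open>b\<close> units of the remaining mass.\<close>

lemma edge_span_flow:
  assumes "finite V" "sum z V = 0" "\<And>u. u \<notin> V \<Longrightarrow> z u = 0" "0 < b"
    and "\<And>u. u \<in> V \<Longrightarrow> b dvd z u" "pos_mass V z \<le> b * int k"
  shows "edge_span V k (\<lambda>u. real_of_int (z u))"
  using assms
proof (induction k arbitrary: z)
  case 0
  have "pos_mass V z = 0" using 0 sum_nonneg[of V "\<lambda>x. max 0 (z x)"] unfolding pos_mass_def by simp
  then have "max 0 (z u) = 0" if "u \<in> V" for u
    using that 0 sum_nonneg_eq_0_iff[of V "\<lambda>x. max 0 (z x)"] unfolding pos_mass_def by auto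
  then have nonpos: "z u \<le> 0" if "u \<in> V" for u using that by (metis max.cobounded2)
  have "(\<Sum>u\<in>V. - z u) = 0" using 0 by (simp add: sum_negf)
  then have "z u = 0" for u
    using nonpos 0 sum_nonneg_eq_0_iff[of V "\<lambda>x. - z x"] by (cases "u \<in> V") auto
  then show ?case by (simp add: zero)
next
  case (Suc k)
  show ?case
  proof (cases "\<exists>u\<in>V. z u \<noteq> 0")
    case False
    then have "z = (\<lambda>_. 0)" using Suc by auto
    then show ?thesis by (simp add: zero)
  next
    case True
    have "\<exists>x\<in>V. z x > 0"
    proof (rule ccontr)
      assume "\<not> ?thesis"
      then have "\<forall>u\<in>V. - z u \<ge> 0" by auto
      moreover have "(\<Sum>u\<in>V. - z u) = 0" using Suc by (simp add: sum_negf)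
      ultimately show False using True Suc sum_nonneg_eq_0_iff[of V "\<lambda>x. - z x"] by auto
    qed
    then obtain x where x: "x \<in> V" "z x > 0" by auto
    have "\<exists>x\<in>V. z x < 0"
    proof (rule ccontr)
      assume "\<not> ?thesis"
      then have "\<forall>u\<in>V. z u \<ge> 0" by auto
      then show False using True Suc sum_nonneg_eq_0_iff[of V z] by auto
    qed
    then obtain y where y: "y \<in> V" "z y < 0" by auto
    have bx: "b \<le> z x" using Suc.prems(5)[OF x(1)] x by (simp add: zdvd_imp_le)
    have by1: "b \<le> - z y" using Suc.prems(5)[OF y(1)] y by (simp add: zdvd_imp_le)
    have xy: "x \<noteq> y" using x y by auto
    let ?z = "z(x := z x - b, y := z y + b)"
    have "edge_span V k (\<lambda>u. real_of_int (?z u))"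
    proof (rule Suc.IH)
      show "finite V" "0 < b" by fact+
      show "sum ?z V = 0" using sum_transfer[OF \<open>finite V\<close> x(1) y(1) xy] Suc by metis
      show "u \<notin> V \<Longrightarrow> ?z u = 0" for u using Suc x y by auto
      show "u \<in> V \<Longrightarrow> b dvd ?z u" for u using Suc x y by auto
      show "pos_mass V ?z \<le> b * int k"
        using pos_mass_update[of V x y z "z x - b" "z y + b"] Suc x y bx by1 xy by (simp add: algebra_simps)
    qed
    then show ?thesis using edge_span_transfer x y xy by metis
  qed
qed

section \<open>Weights of spanning trees\<close>

text \<open>\<open>tree_weight lam Q w\<close> says that some tree with vertex set \<open>Q\<close> has \<open>w\<close> as the product of its edge
  weights. Trees are built by attaching leaves, starting from an arbitrary vertex, which becomes a
  root of the tree.\<close>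

inductive tree_weight :: "('v \<Rightarrow> 'v \<Rightarrow> real) \<Rightarrow> 'v set \<Rightarrow> real \<Rightarrow> bool" for lam where
  single: "tree_weight lam {x} 1"
| grow: "tree_weight lam Q w \<Longrightarrow> y \<in> Q \<Longrightarrow> x \<notin> Q \<Longrightarrow> tree_weight lam (insert x Q) (w * lam y x)"

lemma tree_weight_finite: "tree_weight lam Q w \<Longrightarrow> finite Q \<and> Q \<noteq> {}"
  by (induction rule: tree_weight.induct) auto

lemma tree_weight_pos:
  assumes "tree_weight lam Q w" "\<And>x y. x \<in> Q \<Longrightarrow> y \<in> Q \<Longrightarrow> x \<noteq> y \<Longrightarrow> lam x y > 0"
  shows "w > 0"
  using assms
proof (induction rule: tree_weight.induct)
  case (grow Q w y x)
  have "w > 0" using grow.IH grow.prems by simp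
  moreover have "lam y x > 0" using grow.hyps grow.prems by auto
  ultimately show ?case by simp
qed simp

lemma tree_weight_star:
  assumes "finite S" "p \<notin> S" "\<And>u. u \<in> S \<Longrightarrow> lam p u = c"
  shows "tree_weight lam (insert p S) (c ^ card S)"
  using assms
proof (induction S rule: finite_induct)
  case empty
  then show ?case by (simp add: single)
next
  case (insert x S)
  have "tree_weight lam (insert x (insert p S)) (c ^ card S * lam p x)"
    using insert by (intro grow) auto
  then show ?case using insert by (simp add: insert_commute mult.commute)
qed

lemma tree_weight_star':
  assumes "finite S" "p \<in> S" "\<And>u. u \<in> S \<Longrightarrow> u \<noteq> p \<Longrightarrow> lam p u = c"
  shows "tree_weight lam S (c ^ (card S - 1))"
proof -
  have "tree_weight lam (insert p (S - {p})) (c ^ card (S - {p}))"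
    using assms by (intro tree_weight_star) auto
  then show ?thesis using assms by (simp add: insert_absorb)
qed

text \<open>The star with centre \<open>p\<close>, except that \<open>x'\<close> hangs from \<open>x\<close> instead of \<open>p\<close>.\<close>

lemma tree_weight_broken_star:
  assumes "finite S" "p \<in> S" "x \<in> S" "x' \<in> S" "p \<noteq> x" "p \<noteq> x'" "x \<noteq> x'"
    and "\<And>u. u \<in> S \<Longrightarrow> u \<noteq> p \<Longrightarrow> lam p u = c"
  shows "tree_weight lam S (c ^ (card S - 2) * lam x x')"
proof -
  have "tree_weight lam (S - {x'}) (c ^ (card (S - {x'}) - 1))"
    using assms by (intro tree_weight_star') auto
  then have "tree_weight lam (insert x' (S - {x'})) (c ^ (card (S - {x'}) - 1) * lam x x')"
    using assms by (intro grow) auto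
  moreover have "card (S - {x'}) - 1 = card S - 2" using assms by simp
  moreover have "insert x' (S - {x'}) = S" using assms by auto
  ultimately show ?thesis by metis
qed


section \<open>Cliques whose spanning trees have bounded integral weight\<close>

lemma Ints_pos_ge_1: "x \<in> \<int> \<Longrightarrow> x > 0 \<Longrightarrow> x \<ge> 1" for x :: real
  by (auto elim!: Ints_cases)

text \<open>Two numbers that become integral after multiplication with the same nonzero number have a rational
  ratio, which can be reduced.\<close>

lemma coprime_multiplier:
  fixes p q :: real
  assumes "p > 0" "q > 0" "p \<noteq> q" "w > 0" "p * w \<in> \<int>" "q * w \<in> \<int>"
  obtains g a b where "g > 0" "p = g * real_of_int a" "q = g * real_of_int b" "coprime a b" "a > 0" "b > 0" "a \<noteq> b"
proof -
  from assms obtain m n where mn: "p * w = real_of_int m" "q * w = real_of_int n"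
    by (auto elim!: Ints_cases)
  have pos: "m > 0" "n > 0" using mn assms by (metis mult_pos_pos of_int_0_less_iff)+
  define h where "h = gcd m n"
  have h: "h > 0" using pos unfolding h_def by simp
  obtain a b where ab: "m = h * a" "n = h * b" "coprime a b"
    using gcd_coprime_exists[of m n] h unfolding h_def by (metis less_irrefl mult.commute)
  show ?thesis
  proof
    show "real_of_int h / w > 0" using h assms by simp
    show "p = real_of_int h / w * real_of_int a" using mn ab assms by (simp add: field_simps)
    show "q = real_of_int h / w * real_of_int b" using mn ab assms by (simp add: field_simps)
    show "coprime a b" by fact
    show "a > 0" "b > 0" using ab pos h by (auto simp: zero_less_mult_iff)
    show "a \<noteq> b"
    proof
      assume "a = b"
      then have "p * w = q * w" using ab mn by simp
      then show False using assms by simp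
    qed
  qed
qed

lemma coprime_multiplier_int:
  fixes t :: real
  assumes "t * real_of_int a \<in> \<int>" "t * real_of_int b \<in> \<int>" "coprime a b"
  shows "t \<in> \<int>"
proof -
  obtain u v where "u * a + v * b = 1"
    using assms(3) bezout_int[of a b] by auto
  then have "real_of_int u * real_of_int a + real_of_int v * real_of_int b = 1"
    by (metis of_int_1 of_int_add of_int_mult)
  then have "t = real_of_int u * (t * real_of_int a) + real_of_int v * (t * real_of_int b)"
    by (metis distrib_left mult.left_commute mult.right_neutral)
  then show ?thesis using assms by (metis Ints_add Ints_mult Ints_of_int)
qed

lemma double_le_power: "2 * j \<le> 2 ^ j" if "j \<noteq> 0" for j :: nat
  using that
proof (induction j)
  case (Suc j)
  then show ?case by (cases j) auto
qed simp

lemma double_le_power': "2 * j \<le> (2::nat) ^ j" for j :: nat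
  by (cases "j = 0") (use double_le_power in auto)

text \<open>The numbers \<open>D * w\<close> are the absolute values of the minors at spanning trees, and \<open>N\<close> is the bound
  on all minors.\<close>

locale weighted_clique =
  fixes V :: "'v set" and lam :: "'v \<Rightarrow> 'v \<Rightarrow> real" and D :: real and N :: nat
  assumes finite_V: "finite V"
    and lam_pos: "\<And>x y. x \<in> V \<Longrightarrow> y \<in> V \<Longrightarrow> x \<noteq> y \<Longrightarrow> lam x y > 0"
    and lam_sym: "\<And>x y. x \<in> V \<Longrightarrow> y \<in> V \<Longrightarrow> lam x y = lam y x"
    and D_pos: "D > 0"
    and tree_int: "\<And>w. tree_weight lam V w \<Longrightarrow> D * w \<in> \<int>"
    and tree_le: "\<And>w. tree_weight lam V w \<Longrightarrow> D * w \<le> real N"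
begin

text \<open>\<open>tree_gain Q j\<close> says that trees on \<open>Q\<close> reach at least \<open>2 ^ j\<close> under every multiplier \<open>d\<close> that makes all
  their weights integral. The quantification over \<open>d\<close> lets the property survive the addition of a
  leaf, where the weight of the new edge is absorbed into the multiplier.\<close>

definition tree_gain :: "'v set \<Rightarrow> nat \<Rightarrow> bool" where
  "tree_gain Q j \<longleftrightarrow> (\<exists>w. tree_weight lam Q w) \<and>
     (\<forall>d>0. (\<forall>w. tree_weight lam Q w \<longrightarrow> d * w \<in> \<int>) \<longrightarrow> (\<exists>w. tree_weight lam Q w \<and> d * w \<ge> 2 ^ j))"

lemma tree_gain_single: "tree_gain {x} 0"
  unfolding tree_gain_def using tree_weight.single[of lam x] Ints_pos_ge_1 by force

lemma tree_gain_extend: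
  assumes "tree_gain Q j" "Q \<subseteq> V" "x \<in> V - Q" "y \<in> Q"
  shows "tree_gain (insert x Q) j"
  unfolding tree_gain_def
proof (intro conjI allI impI)
  show "\<exists>w. tree_weight lam (insert x Q) w"
    using assms tree_weight.grow[of lam Q _ y x] unfolding tree_gain_def by blast
next
  fix d :: real
  assume d: "d > 0" "\<forall>w. tree_weight lam (insert x Q) w \<longrightarrow> d * w \<in> \<int>"
  have grow: "tree_weight lam (insert x Q) (w * lam y x)" if "tree_weight lam Q w" for w
    using that assms by (intro tree_weight.grow) auto
  have "lam y x > 0" using assms by (intro lam_pos) auto
  then have "d * lam y x > 0" using d by simp
  moreover have "d * lam y x * w \<in> \<int>" if "tree_weight lam Q w" for w
    using d(2) grow[OF that] by (metis mult.assoc mult.commute)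
  ultimately obtain w where "tree_weight lam Q w" "d * lam y x * w \<ge> 2 ^ j"
    using assms(1) unfolding tree_gain_def by blast
  then show "\<exists>w. tree_weight lam (insert x Q) w \<and> d * w \<ge> 2 ^ j"
    using grow by (metis mult.assoc mult.commute)
qed

text \<open>Reduce the ratio of the two weights at \<open>x\<close> to \<open>a / b\<close>. As \<open>d\<close> times either weight is a valid
  multiplier for the trees on \<open>Q\<close>, so is \<open>d\<close> times their common divisor \<open>g\<close>; and one of \<open>a\<close> and \<open>b\<close>
  is at least 2.\<close>

lemma tree_gain_exchange:
  assumes gain: "tree_gain Q j" and Q: "Q \<subseteq> V" and x: "x \<in> V - Q" and y: "y \<in> Q" "y' \<in> Q"
    and ne: "lam y x \<noteq> lam y' x"
  shows "tree_gain (insert x Q) (Suc j)"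
  unfolding tree_gain_def
proof (intro conjI allI impI)
  show "\<exists>w. tree_weight lam (insert x Q) w"
    using gain x y tree_weight.grow[of lam Q _ y x] unfolding tree_gain_def by blast
next
  fix d :: real
  assume d: "d > 0" "\<forall>w. tree_weight lam (insert x Q) w \<longrightarrow> d * w \<in> \<int>"
  have grow: "tree_weight lam (insert x Q) (w * lam u x)" if "tree_weight lam Q w" "u \<in> Q" for w u
    using that x by (intro tree_weight.grow) auto
  have lpos: "lam y x > 0" "lam y' x > 0" using x y Q by (auto intro!: lam_pos)
  obtain w0 where w0: "tree_weight lam Q w0" using gain unfolding tree_gain_def by blast
  have "w0 > 0" by (rule tree_weight_pos[OF w0]) (use Q lam_pos in auto)
  obtain g a b where g: "g > 0" "lam y x = g * real_of_int a" "lam y' x = g * real_of_int b"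
      and ab: "coprime a b" "a > 0" "b > 0" "a \<noteq> b"
  proof (rule coprime_multiplier[OF lpos ne, of "d * w0"])
    show "d * w0 > 0" using d \<open>w0 > 0\<close> by simp
    show "lam y x * (d * w0) \<in> \<int>" "lam y' x * (d * w0) \<in> \<int>"
      using d(2) grow[OF w0] y by (metis mult.assoc mult.commute)+
  qed
  have "d * g * w \<in> \<int>" if w: "tree_weight lam Q w" for w
  proof (rule coprime_multiplier_int[OF _ _ ab(1)])
    have "d * (w * lam y x) \<in> \<int>" "d * (w * lam y' x) \<in> \<int>"
      using d(2) grow[OF w] y by blast+
    then show "d * g * w * real_of_int a \<in> \<int>" "d * g * w * real_of_int b \<in> \<int>"
      using g by (simp_all add: mult_ac)
  qed
  moreover have "d * g > 0" using d g by simp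
  ultimately obtain w where w: "tree_weight lam Q w" "d * g * w \<ge> 2 ^ j"
    using gain unfolding tree_gain_def by blast
  obtain u where u: "u \<in> Q" "lam u x \<ge> g * 2"
  proof (cases "a \<ge> 2")
    case True
    then show ?thesis using that[of y] y g by simp
  next
    case False
    then have "b \<ge> 2" using ab by auto
    then show ?thesis using that[of y'] y g by simp
  qed
  have dw: "d * w > 0" using w g by (smt (verit) mult.assoc mult.commute zero_less_mult_pos zero_less_power)
  have "2 ^ Suc j \<le> d * g * w * 2" using w by simp
  also have "\<dots> = d * w * (g * 2)" by simp
  also have "\<dots> \<le> d * w * lam u x" using u dw by (intro mult_left_mono) auto
  finally show "\<exists>w. tree_weight lam (insert x Q) w \<and> d * w \<ge> 2 ^ Suc j"
    using grow[OF w(1) u(1)] by (metis mult.assoc)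
qed

lemma tree_gain_union:
  assumes "tree_gain Q j" "Q \<subseteq> V" "finite R" "R \<subseteq> V" "y \<in> Q"
  shows "tree_gain (Q \<union> R) j"
  using assms(3,4)
proof (induction R rule: finite_induct)
  case (insert x R)
  show ?case
  proof (cases "x \<in> Q")
    case True
    then show ?thesis using insert by (simp add: insert_absorb)
  next
    case False
    then have "tree_gain (insert x (Q \<union> R)) j"
      using insert assms by (intro tree_gain_extend[of _ _ _ y]) auto
    then show ?thesis by simp
  qed
qed (use assms in simp)

text \<open>Attaching the remaining vertices arbitrarily turns a tree on \<open>Q\<close> into a spanning tree.\<close>

lemma tree_gain_bound:
  assumes "tree_gain Q j" "Q \<subseteq> V"
  shows "2 ^ j \<le> N"
proof -
  obtain y where "y \<in> Q" using assms tree_weight_finite unfolding tree_gain_def by blast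
  then have "tree_gain (Q \<union> V) j" using assms finite_V by (intro tree_gain_union[of _ _ _ y]) auto
  then have "tree_gain V j" using assms by (simp add: Un_absorb1)
  then obtain w where "tree_weight lam V w" "D * w \<ge> 2 ^ j"
    using D_pos tree_int unfolding tree_gain_def by blast
  then have "(2::real) ^ j \<le> real N" using tree_le[of w] by linarith
  then have "real (2 ^ j) \<le> real N" by (simp only: of_nat_power of_nat_numeral)
  then show ?thesis by (simp only: of_nat_le_iff)
qed

text \<open>Take \<open>Q\<close> with the largest gain \<open>j\<close> among the sets that contain \<open>p\<close> and have at most \<open>2 * j + 1\<close>
  vertices. Two edges of different weight from a vertex outside to \<open>Q\<close>, or in a triangle with one
  vertex in \<open>Q\<close> and two outside, would allow another exchange at the price of at most two vertices.\<close>

lemma uniform_outside: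
  assumes p: "p \<in> V"
  obtains Q j c where "p \<in> Q" "Q \<subseteq> V" "card Q \<le> 2 * j + 1" "2 ^ j \<le> N"
    "\<And>x u. x \<in> V - Q \<Longrightarrow> u \<in> V - {x} \<Longrightarrow> lam x u = c"
proof -
  define good where "good Q j \<longleftrightarrow> p \<in> Q \<and> Q \<subseteq> V \<and> card Q \<le> 2 * j + 1 \<and> tree_gain Q j" for Q j
  have "good {p} 0" using p tree_gain_single unfolding good_def by simp
  then have ex: "\<exists>Q. good Q 0" by blast
  have bound: "j \<le> N" if "\<exists>Q. good Q j" for j
    using that tree_gain_bound less_exp[of j] unfolding good_def by (meson le_trans less_imp_le)
  define j where "j = (GREATEST j. \<exists>Q. good Q j)"
  have "\<exists>Q. good Q j" unfolding j_def
    by (rule GreatestI_nat[where P = "\<lambda>j. \<exists>Q. good Q j", OF ex]) (use bound in blast)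
  then obtain Q where Q: "good Q j" by blast
  have max: "\<not> good Q' (Suc j)" for Q'
  proof
    assume "good Q' (Suc j)"
    then have "Suc j \<le> j" unfolding j_def
      by (intro Greatest_le_nat[where P = "\<lambda>j. \<exists>Q. good Q j"]) (use bound in blast)+
    then show False by simp
  qed
  have finQ: "finite Q" using Q finite_V finite_subset unfolding good_def by blast
  have inner: "lam u x = lam p x" if "x \<in> V - Q" "u \<in> Q" for x u
  proof (rule ccontr)
    assume "lam u x \<noteq> lam p x"
    then have "tree_gain (insert x Q) (Suc j)"
      using Q that tree_gain_exchange[of Q j x u p] unfolding good_def by blast
    then have "good (insert x Q) (Suc j)"
      using Q that finQ unfolding good_def by auto
    then show False using max by blast
  qed
  have outer: "lam x u = lam p x" if xu: "x \<in> V - Q" "u \<in> V - Q" "x \<noteq> u" for x u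
  proof (rule ccontr)
    assume "lam x u \<noteq> lam p x"
    then have ne: "lam u x \<noteq> lam p x" using lam_sym xu by auto
    have "tree_gain (insert u Q) j"
      using Q xu tree_gain_extend[of Q j u p] unfolding good_def by blast
    then have "tree_gain (insert x (insert u Q)) (Suc j)"
      using ne Q xu by (intro tree_gain_exchange[of _ _ _ u p]) (auto simp: good_def)
    then have "good (insert x (insert u Q)) (Suc j)"
      using Q xu finQ unfolding good_def by auto
    then show False using max by blast
  qed
  show ?thesis
  proof (cases "V - Q = {}")
    case True
    then show ?thesis using that[of Q j] Q tree_gain_bound unfolding good_def by blast
  next
    case False
    then obtain q where q: "q \<in> V - Q" by blast
    have const: "lam p x = lam p q" if "x \<in> V - Q" for x
      using outer[of x q] outer[of q x] lam_sym[of x q] that q by (cases "x = q") auto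
    show ?thesis
    proof (rule that[of Q j "lam p q"])
      show "lam x u = lam p q" if "x \<in> V - Q" "u \<in> V - {x}" for x u
      proof (cases "u \<in> Q")
        case True
        then show ?thesis using inner[of x u] const[of x] that lam_sym[of x u] by auto
      next
        case False
        then show ?thesis using outer[of x u] const[of x] that by auto
      qed
    qed (use Q tree_gain_bound in \<open>auto simp: good_def\<close>)
  qed
qed

text \<open>A first application of \<open>uniform_outside\<close> provides a vertex \<open>q\<close> all of whose edges have the same
  weight \<open>c\<close>. A second one, which starts at \<open>q\<close>, provides a set \<open>R\<close> that contains \<open>q\<close> such that every edge
  with an end outside \<open>R\<close> has the weight \<open>c\<close> as well. So all irregular vertices lie in \<open>R - {q}\<close>, which
  has at most \<open>2 * k \<le> 2 ^ k \<le> N\<close> elements.\<close>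

lemma regular_vertices:
  assumes big: "N + 2 \<le> card V"
  obtains G c where "G \<subseteq> V" "2 \<le> card G" "card (V - G) \<le> N" "c > 0"
    "\<forall>x\<in>G. \<forall>u\<in>V - {x}. lam x u = c"
proof -
  have "V \<noteq> {}" using big by auto
  then obtain p where p: "p \<in> V" by blast
  obtain Q j c where Q: "p \<in> Q" "Q \<subseteq> V" "card Q \<le> 2 * j + 1" "2 ^ j \<le> N"
    and c: "\<And>x u. x \<in> V - Q \<Longrightarrow> u \<in> V - {x} \<Longrightarrow> lam x u = c"
    using uniform_outside[OF p] by blast
  have "card Q < card V" using Q double_le_power'[of j] big by linarith
  then have "V - Q \<noteq> {}" using Q finite_V by (metis Diff_eq_empty_iff antisym less_irrefl)
  then obtain q where q: "q \<in> V - Q" by blast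
  obtain R k c' where R: "q \<in> R" "R \<subseteq> V" "card R \<le> 2 * k + 1" "2 ^ k \<le> N"
    and c': "\<And>x u. x \<in> V - R \<Longrightarrow> u \<in> V - {x} \<Longrightarrow> lam x u = c'"
    using uniform_outside[of q] q by blast
  have "card R < card V" using R double_le_power'[of k] big by linarith
  then have "V - R \<noteq> {}" using R finite_V by (metis Diff_eq_empty_iff antisym less_irrefl)
  then obtain s where s: "s \<in> V - R" by blast
  have cc: "c' = c" using c[of q s] c'[of s q] q s R lam_sym[of q s] by auto
  have VR: "V - insert q (V - R) = R - {q}" using R by auto
  have cR: "card (R - {q}) \<le> N"
    using R double_le_power'[of k] by simp
  show ?thesis
  proof (rule that[of "insert q (V - R)" c])
    show "card (V - insert q (V - R)) \<le> N" using cR VR by simp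
    have "card (insert q (V - R)) = card V - card (R - {q})"
      using VR finite_V q R
      by (metis Diff_subset card_Diff_subset double_diff finite_Diff insert_subset Diff_iff order_refl)
    then show "2 \<le> card (insert q (V - R))" using cR big by simp
    show "c > 0" using c[of q s] lam_pos[of q s] q s R by auto
    show "\<forall>x\<in>insert q (V - R). \<forall>u\<in>V - {x}. lam x u = c"
      using c[of q] c' cc q by auto
  qed (use q R in auto)
qed

end

section \<open>Zero-sum vectors with bounded integral cuts\<close>

text \<open>The vector \<open>v\<close> stands for an element of the matroid, and the vertices in \<open>G\<close> are called regular: all
  their edges have weight \<open>c\<close>. Edges of another weight are called exceptional.\<close>

locale cut_bounded = weighted_clique V lam D N
  for V :: "'v set" and lam D N +
  fixes v :: "'v \<Rightarrow> real" and G :: "'v set" and c :: real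
  assumes v_sum: "sum v V = 0"
    and v_out: "\<And>u. u \<notin> V \<Longrightarrow> v u = 0"
    and cut_int: "\<And>S w w'. S \<subseteq> V \<Longrightarrow> tree_weight lam S w \<Longrightarrow> tree_weight lam (V - S) w' \<Longrightarrow>
          D * w * w' * sum v S \<in> \<int>"
    and cut_le: "\<And>S w w'. S \<subseteq> V \<Longrightarrow> tree_weight lam S w \<Longrightarrow> tree_weight lam (V - S) w' \<Longrightarrow>
          \<bar>D * w * w' * sum v S\<bar> \<le> real N"
    and G_sub: "G \<subseteq> V" and G_card: "2 \<le> card G" and rest_card: "card (V - G) \<le> N"
    and c_pos: "c > 0"
    and regular: "\<And>x u. x \<in> G \<Longrightarrow> u \<in> V - {x} \<Longrightarrow> lam x u = c"
begin

text \<open>The element represented by \<open>v\<close> is also represented by \<open>- v\<close>; this exchanges the roles of positive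
  and negative entries.\<close>

lemma cut_bounded_minus: "cut_bounded V lam D N (\<lambda>u. - v u) G c"
proof unfold_locales
  fix S w w' assume *: "S \<subseteq> V" "tree_weight lam S w" "tree_weight lam (V - S) w'"
  show "D * w * w' * sum (\<lambda>u. - v u) S \<in> \<int>"
    using cut_int[OF *] by (simp add: sum_negf)
  show "\<bar>D * w * w' * sum (\<lambda>u. - v u) S\<bar> \<le> real N"
    using cut_le[OF *] by (simp add: sum_negf)
qed (use v_sum v_out G_sub G_card rest_card c_pos regular in \<open>auto simp: sum_negf\<close>)

text \<open>This multiple of \<open>v\<close> makes \<open>sum z S\<close> the minor, up to sign, at the element that \<open>v\<close> stands for and two
  trees all of whose edges have weight \<open>c\<close>, one on each side of the cut. In particular, the one-vertex
  sets \<open>S\<close> show that the rounding in the definition of \<open>z\<close> below changes nothing.\<close>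

definition scale :: real where "scale = D * c ^ (card V - 2)"

definition z :: "'v \<Rightarrow> int" where "z u = \<lfloor>scale * v u\<rfloor>"

definition centered :: "'v set \<Rightarrow> bool" where
  "centered S \<longleftrightarrow> S \<subseteq> V \<and> (\<exists>p\<in>S. \<forall>u\<in>S - {p}. lam p u = c)"

lemma centered_regular: "S \<subseteq> V \<Longrightarrow> y \<in> G \<Longrightarrow> y \<in> S \<Longrightarrow> centered S"
  unfolding centered_def using regular by blast

lemma centered_tree: "centered S \<Longrightarrow> tree_weight lam S (c ^ (card S - 1))"
  unfolding centered_def using finite_V finite_subset tree_weight_star' by (metis Diff_iff singletonD)

lemma scale_pos: "scale > 0"
  unfolding scale_def using D_pos c_pos by simp

lemma other_regular: obtains y where "y \<in> G" "y \<noteq> x"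
proof -
  have "\<not> G \<subseteq> {x}" using G_card card_mono[of "{x}" G] by fastforce
  then show ?thesis using that by blast
qed

lemma card_split: "S \<subseteq> V \<Longrightarrow> card S + card (V - S) = card V"
  using finite_V by (metis card_Diff_subset card_mono finite_subset le_add_diff_inverse)

lemma cut_centered:
  assumes "centered S" "centered (V - S)"
  shows "scale * sum v S \<in> \<int>" "\<bar>scale * sum v S\<bar> \<le> real N"
proof -
  have S: "S \<subseteq> V" using assms unfolding centered_def by blast
  have "S \<noteq> {}" "V - S \<noteq> {}" using assms unfolding centered_def by auto
  then have "card S > 0" "card (V - S) > 0" using finite_V S by (auto simp: card_gt_0_iff finite_subset)
  then have "card V - 2 = (card S - 1) + (card (V - S) - 1)" using card_split[OF S] by simp
  then have "scale = D * c ^ (card S - 1) * c ^ (card (V - S) - 1)"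
    unfolding scale_def by (simp add: power_add)
  then show "scale * sum v S \<in> \<int>" "\<bar>scale * sum v S\<bar> \<le> real N"
    using cut_int[OF S] cut_le[OF S] centered_tree assms by auto
qed

text \<open>The cut is the same as in \<open>cut_centered\<close>, but the tree on \<open>S\<close> uses the edge \<open>xx'\<close> in place of an edge
  of weight \<open>c\<close>.\<close>

lemma cut_broken:
  assumes "S \<subseteq> V" "p \<in> S" "p \<in> G" "x \<in> S" "x' \<in> S" "p \<noteq> x" "p \<noteq> x'" "x \<noteq> x'" "centered (V - S)"
  shows "lam x x' / c * (scale * sum v S) \<in> \<int>" "\<bar>lam x x' / c * (scale * sum v S)\<bar> \<le> real N"
proof -
  have S: "S \<subseteq> V" using assms by blast
  have finS: "finite S" using S finite_V finite_subset by blast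
  have "V - S \<noteq> {}" using assms unfolding centered_def by auto
  then have pos: "card (V - S) > 0" using finite_V S by (auto simp: card_gt_0_iff finite_subset)
  have "card {p, x, x'} \<le> card S" using assms finS by (intro card_mono) auto
  then have "card S \<ge> 3" using assms by simp
  then have "card V - 2 = Suc ((card S - 2) + (card (V - S) - 1))" using card_split[OF S] pos by simp
  then have "scale = D * c ^ (card S - 2) * c ^ (card (V - S) - 1) * c"
    unfolding scale_def by (simp add: power_add)
  then have eq: "lam x x' / c * (scale * sum v S) =
      D * (c ^ (card S - 2) * lam x x') * c ^ (card (V - S) - 1) * sum v S"
    using c_pos by simp
  have "tree_weight lam S (c ^ (card S - 2) * lam x x')"
    using assms finS by (intro tree_weight_broken_star[of _ p]) (auto intro!: regular)
  then show "lam x x' / c * (scale * sum v S) \<in> \<int>" "\<bar>lam x x' / c * (scale * sum v S)\<bar> \<le> real N"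
    unfolding eq using cut_int[OF S] cut_le[OF S] centered_tree assms by blast+
qed

lemma centered_singleton: "u \<in> V \<Longrightarrow> centered {u}"
  unfolding centered_def by auto

lemma centered_co_singleton: "u \<in> V \<Longrightarrow> centered (V - {u})"
  using other_regular[of u] centered_regular[of "V - {u}"] G_sub by blast

lemma z_real: "real_of_int (z u) = scale * v u"
proof (cases "u \<in> V")
  case True
  then have "scale * v u \<in> \<int>"
    using cut_centered(1)[of "{u}"] centered_singleton centered_co_singleton by simp
  then show ?thesis unfolding z_def by (auto elim!: Ints_cases)
next
  case False
  then show ?thesis unfolding z_def using v_out by simp
qed

lemma z_sum_real: "real_of_int (sum z S) = scale * sum v S"
  by (simp add: z_real sum_distrib_left)

lemma z_le: "u \<in> V \<Longrightarrow> \<bar>z u\<bar> \<le> int N"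
  using cut_centered(2)[of "{u}"] centered_singleton centered_co_singleton z_real[of u]
  by (simp flip: of_int_abs)

lemma z_sum_le: "centered S \<Longrightarrow> centered (V - S) \<Longrightarrow> \<bar>sum z S\<bar> \<le> int N"
  using cut_centered(2)[of S] unfolding z_sum_real[symmetric] by linarith

lemma z_pos_iff: "z u > 0 \<longleftrightarrow> v u > 0"
  using z_real[of u] scale_pos by (metis of_int_0_less_iff zero_less_mult_pos mult_pos_pos)

lemma z_sum: "sum z V = 0"
proof -
  have "real_of_int (sum z V) = 0" unfolding z_sum_real v_sum by simp
  then show ?thesis by (simp only: of_int_eq_0_iff)
qed

lemma z_out: "u \<notin> V \<Longrightarrow> z u = 0"
  unfolding z_def using v_out by simp

lemma edge_span_z: "edge_span V k (\<lambda>u. real_of_int (z u)) \<Longrightarrow> edge_span V k v"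
  using edge_span_scale[of V k "\<lambda>u. real_of_int (z u)" "1 / scale"] scale_pos
  by (simp add: z_real)

lemma pos_mass_eq: "pos_mass V z = sum z {u \<in> V. v u > 0}"
  unfolding pos_mass_def sum.inter_filter[OF finite_V] z_pos_iff[symmetric]
  by (intro sum.cong) auto

lemma edge_span_pos_mass:
  assumes "pos_mass V z \<le> int N"
  shows "edge_span V N v"
  by (rule edge_span_z, rule edge_span_flow[where b = 1]) (use assms finite_V z_sum z_out in auto)

text \<open>The case in which the positive entries contain an exceptional edge but no regular vertex, so that they
  need not form a centered set. A regular vertex \<open>y\<close> added to the positive side makes it centered, at
  the price of replacing the mass \<open>P\<close> by \<open>P + z y\<close>. With two regular vertices at hand this yields
  \<open>P \<le> 2 * N\<close>, and the edge \<open>xx'\<close> makes up for the missing factor 2.\<close>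

lemma edge_span_exceptional_edge:
  assumes x: "x \<in> V" "v x > 0" and x': "x' \<in> V" "v x' > 0" and ne: "x \<noteq> x'" "lam x x' \<noteq> c"
    and G_nonpos: "\<And>y. y \<in> G \<Longrightarrow> v y \<le> 0"
  shows "edge_span V N v"
proof -
  define P where "P = pos_mass V z"
  define S where "S = {u \<in> V. v u > 0}"
  define mu where "mu = lam x x' / c"
  have S: "S \<subseteq> V" "S \<inter> G = {}" "x \<in> S" "x' \<in> S" using x x' G_nonpos unfolding S_def by force+
  have finS: "finite S" using S finite_V finite_subset by blast
  have "card S \<le> card (V - G)" using S finite_V by (intro card_mono) auto
  then have cardS: "card S \<le> N" using rest_card by simp
  have PS: "P = sum z S" unfolding P_def S_def by (rule pos_mass_eq)
  have mu_pos: "mu > 0" unfolding mu_def using lam_pos x x' ne c_pos by simp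
  have mu_ne: "mu \<noteq> 1" unfolding mu_def using ne c_pos by simp
  have cut: "P + z y \<le> int N" "mu * \<bar>real_of_int (P + z y)\<bar> \<le> real N" if y: "y \<in> G" for y
  proof -
    obtain y' where y': "y' \<in> G" "y' \<noteq> y" by (rule other_regular)
    have yS: "y \<notin> S" using S y by auto
    have cent: "centered (insert y S)"
      using S y G_sub by (intro centered_regular[of _ y]) auto
    have cent': "centered (V - insert y S)"
      using S y' G_sub by (intro centered_regular[of _ y']) auto
    have sum: "sum z (insert y S) = P + z y" using yS finS PS by simp
    show "P + z y \<le> int N" using z_sum_le[OF cent cent'] sum by linarith
    have "\<bar>mu * (scale * sum v (insert y S))\<bar> \<le> real N"
      unfolding mu_def using cent' S y G_sub ne yS
      by (intro cut_broken(2)[of "insert y S" y x x']) auto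
    then show "mu * \<bar>real_of_int (P + z y)\<bar> \<le> real N"
      unfolding z_sum_real[symmetric] sum using mu_pos by (simp add: abs_mult)
  qed
  obtain y where y: "y \<in> G" by (rule other_regular)
  obtain y' where y': "y' \<in> G" "y' \<noteq> y" by (rule other_regular)
  have yV: "y \<in> V" "y' \<in> V" using y y' G_sub by auto
  have z_nonpos: "z w \<le> 0" if "w \<in> G" for w using z_pos_iff[of w] G_nonpos[OF that] by force
  show ?thesis
  proof (cases "z y = 0 \<or> z y' = 0")
    case True
    then have "P \<le> int N" using cut(1)[OF y] cut(1)[OF y'(1)] by auto
    then show ?thesis using edge_span_pos_mass unfolding P_def by simp
  next
    case False
    then have neg: "z y < 0" "z y' < 0" using z_nonpos y y' by force+
    have two: "P \<ge> - z y - z y'"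
    proof -
      have "(\<Sum>u\<in>{y, y'}. max 0 (z u) - z u) \<le> (\<Sum>u\<in>V. max 0 (z u) - z u)"
        using yV finite_V by (intro sum_mono2) auto
      also have "\<dots> = P" unfolding P_def pos_mass_def using z_sum by (simp add: sum_subtractf)
      finally show ?thesis using y' neg by simp
    qed
    have P_le: "P \<le> 2 * int N" using cut(1)[OF y] cut(1)[OF y'(1)] two by linarith
    \<comment> \<open>The cut that separates \<open>w\<close> from the rest, with the edge \<open>xx'\<close> in the tree on the large side.\<close>
    have mu_int: "mu * real_of_int (z w) \<in> \<int>" if w: "w \<in> V - {x, x'}" for w
    proof -
      obtain p where p: "p \<in> G" "p \<noteq> w" by (rule other_regular)
      have "mu * (scale * sum v (V - {w})) \<in> \<int>"
        unfolding mu_def using p w S ne x x' G_sub centered_singleton[of w]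
        by (intro cut_broken(1)[of "V - {w}" p x x']) (auto simp: double_diff)
      moreover have "sum v (V - {w}) = - v w" using w finite_V v_sum by (simp add: sum_diff1)
      ultimately have "- (mu * (scale * v w)) \<in> \<int>" by simp
      then show ?thesis unfolding z_real by (metis Ints_minus minus_minus)
    qed
    have yx: "y \<notin> {x, x'}" "y' \<notin> {x, x'}" using S y y' by auto
    obtain g a b where g: "g > 0" "mu = g * real_of_int a" "1 = g * real_of_int b"
        and ab: "coprime a b" "a > 0" "b > 0" "a \<noteq> b"
    proof (rule coprime_multiplier[of mu 1 "- real_of_int (z y)"])
      show "mu * - real_of_int (z y) \<in> \<int>" using mu_int[of y] yx yV by simp
    qed (use mu_pos mu_ne neg in auto)
    have mu_b: "mu * real_of_int b = real_of_int a" using g by (simp add: field_simps)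
    have b_dvd: "b dvd z w" if w: "w \<in> V - {x, x'}" for w
    proof -
      obtain m where "mu * real_of_int (z w) = real_of_int m"
        using mu_int[OF w] by (auto elim: Ints_cases)
      then have "real_of_int a * real_of_int (z w) = real_of_int b * real_of_int m"
        using mu_b by (metis mult.assoc mult.commute)
      then have "a * z w = b * m" by (metis of_int_eq_iff of_int_mult)
      then show ?thesis using ab(1) by (metis coprime_commute coprime_dvd_mult_right_iff dvd_triv_left)
    qed
    have V_split: "V = insert x (insert x' (V - {x, x'}))" using x x' by auto
    have b_dvd2: "b dvd z x + z x'"
    proof -
      have "sum z V = z x + (z x' + sum z (V - {x, x'}))"
        by (subst V_split) (use finite_V ne in simp)
      then have "z x + z x' = - sum z (V - {x, x'})" using z_sum by simp
      moreover have "b dvd sum z (V - {x, x'})" using b_dvd by (intro dvd_sum) auto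
      ultimately show ?thesis by simp
    qed
    show ?thesis
    proof (cases "b = 1")
      case True
      then have "mu \<ge> 2" using g ab by simp
      have le: "2 * (P + z w) \<le> int N" if "w \<in> G" for w
      proof -
        define t where "t = real_of_int (P + z w)"
        have "2 * \<bar>t\<bar> \<le> mu * \<bar>t\<bar>"
          using \<open>mu \<ge> 2\<close> by (intro mult_right_mono) auto
        then have "2 * t \<le> real N" using cut(2)[OF that] unfolding t_def[symmetric] by linarith
        then have "real_of_int (2 * (P + z w)) \<le> real_of_int (int N)" unfolding t_def by simp
        then show ?thesis by (simp only: of_int_le_iff)
      qed
      have "P \<le> int N" using le[OF y] le[OF y'(1)] two by (simp add: algebra_simps)
      then show ?thesis using edge_span_pos_mass unfolding P_def by simp
    next
      case False
      then have b2: "b \<ge> 2" using ab by simp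
      \<comment> \<open>Merging \<open>x'\<close> into \<open>x\<close> costs one edge and makes all entries divisible by \<open>b\<close>.\<close>
      define z' where "z' = z(x := z x - - z x', x' := z x' + - z x')"
      have z'_dvd: "b dvd z' u" if "u \<in> V" for u
        using that b_dvd[of u] b_dvd2 unfolding z'_def by auto
      have zx: "z x > 0" "z x' > 0" using z_pos_iff x x' by auto
      have z'_mass: "pos_mass V z' = P"
        unfolding z'_def P_def using pos_mass_update[of V x x' z "z x - - z x'" "z x' + - z x'"]
          finite_V x x' ne zx by simp
      have z'_sum: "sum z' V = 0"
        unfolding z'_def using sum_transfer[of V x x' z "- z x'"] finite_V x x' ne z_sum by metis
      have z'_out: "u \<notin> V \<Longrightarrow> z' u = 0" for u unfolding z'_def using x x' z_out by auto
      have from_z': "edge_span V N v" if "edge_span V k (\<lambda>u. real_of_int (z' u))" "Suc k \<le> N" for k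
        using edge_span_transfer[OF that(1)[unfolded z'_def] x(1) x'(1) ne(1)] edge_span_mono[OF _ that(2)]
          edge_span_z by blast
      have "b dvd P" unfolding z'_mass[symmetric] pos_mass_def
        using z'_dvd by (intro dvd_sum) (auto simp: max_def)
      then obtain k0 where k0: "P = b * k0" by blast
      have "P \<ge> 0" unfolding P_def pos_mass_def by (intro sum_nonneg) auto
      then have "k0 \<ge> 0" using k0 ab by (simp add: zero_le_mult_iff)
      then obtain k where k: "P = b * int k" using k0 by (metis nonneg_int_cases)
      have span_k: "edge_span V k (\<lambda>u. real_of_int (z' u))"
        using finite_V z'_sum z'_out ab z'_dvd z'_mass k by (intro edge_span_flow[where b = b]) auto
      have N_ge: "b \<le> int N"
        using b_dvd[of y] yx yV neg z_le[OF yV(1)] zdvd_imp_le[of b "- z y"] by auto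
      show ?thesis
      proof (cases "Suc k \<le> N")
        case True
        then show ?thesis using from_z'[OF span_k] by blast
      next
        case k_big: False
        \<comment> \<open>The bound \<open>P / b + 1\<close> on the number of edges exceeds \<open>N\<close> only if \<open>b = 2\<close> and \<open>P = 2 * N\<close>, so one
          edge has to be saved.\<close>
        have "b = 2"
        proof (rule ccontr)
          assume "b \<noteq> 2"
          then have "b \<ge> 3" using b2 by simp
          then have "3 * int k \<le> 2 * int N" using P_le k mult_right_mono[of 3 b "int k"] by (simp add: algebra_simps)
          then show False using k_big N_ge \<open>b \<ge> 3\<close> by linarith
        qed
        then have "P = 2 * int k" "int k \<ge> int N" using k k_big by simp_all
        then have PN: "P = 2 * int N" using P_le by linarith
        have zy: "z y = - int N"
          using cut(1)[OF y] cut(1)[OF y'(1)] two PN z_le[OF yV(1)] z_le[OF yV(2)] by linarith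
        show ?thesis
        proof (cases "N \<ge> 4")
          case False
          \<comment> \<open>If \<open>N = 2\<close>, the only positive entries are \<open>z x = z x' = 2\<close>, and nothing needs to be merged.\<close>
          have "even N" using b_dvd[of y] yx yV \<open>b = 2\<close> zy by simp
          then have N2: "N = 2" using False N_ge \<open>b = 2\<close> by presburger
          have "{x, x'} = S" using S finS ne cardS N2 by (intro card_seteq) auto
          moreover have "sum z {x, x'} = z x + z x'" using ne by simp
          ultimately have "z x + z x' = 4" using PS PN N2 by simp
          then have "z x = 2" "z x' = 2" using z_le[OF x(1)] z_le[OF x'(1)] N2 by auto
          then have "2 dvd z u" if "u \<in> V" for u
            using b_dvd[of u] that \<open>b = 2\<close> by (cases "u = x \<or> u = x'") auto
          then have "edge_span V N (\<lambda>u. real_of_int (z u))"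
            using finite_V z_sum z_out PN unfolding P_def by (intro edge_span_flow[where b = 2]) auto
          then show ?thesis by (rule edge_span_z)
        next
          case True
          \<comment> \<open>After the merger at most \<open>N - 1\<close> positive entries carry the mass \<open>2 * N\<close>. So one of them is
            at least 4, and as \<open>z y \<le> - 4\<close>, the edge \<open>uy\<close> can carry two portions at once.\<close>
          have "\<exists>u\<in>S. z' u \<ge> 4"
          proof (rule ccontr)
            assume *: "\<not> ?thesis"
            have small: "z' u \<le> 2" if "u \<in> S" for u
            proof -
              have "z' u < 4" using * that by auto
              moreover have "even (z' u)" using z'_dvd[of u] that S \<open>b = 2\<close> by auto
              ultimately show ?thesis by presburger
            qed
            have "z' u \<le> 0" if "u \<in> V - S" for u
              using that z_pos_iff[of u] S unfolding z'_def S_def by auto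
            then have "P = (\<Sum>u\<in>S. max 0 (z' u))"
              unfolding z'_mass[symmetric] pos_mass_def using S finite_V
              by (intro sum.mono_neutral_right) auto
            also have "\<dots> = max 0 (z' x') + (\<Sum>u\<in>S - {x'}. max 0 (z' u))"
              using S finS by (intro sum.remove) auto
            also have "\<dots> \<le> 0 + (\<Sum>u\<in>S - {x'}. 2)"
            proof (intro add_mono sum_mono)
              show "max 0 (z' x') \<le> 0" unfolding z'_def by simp
              show "max 0 (z' w) \<le> 2" if "w \<in> S - {x'}" for w using small[of w] that by simp
            qed
            also have "\<dots> = 2 * int (card S - 1)" using S finS by simp
            also have "\<dots> < 2 * int N" using cardS True by auto
            finally show False using PN by simp
          qed
          then obtain u where u: "u \<in> S" "z' u \<ge> 4" by blast
          have uV: "u \<in> V" and uy: "u \<noteq> y" using u S y by auto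
          have z'y: "z' y = - int N" using zy yx unfolding z'_def by simp
          define z'' where "z'' = z'(u := z' u - 4, y := z' y + 4)"
          have "edge_span V (N - 2) (\<lambda>w. real_of_int (z'' w))"
          proof (rule edge_span_flow[where b = 2])
            show "sum z'' V = 0"
              unfolding z''_def using sum_transfer[of V u y z' 4] finite_V uV yV uy z'_sum by metis
            show "w \<notin> V \<Longrightarrow> z'' w = 0" for w unfolding z''_def using uV yV z'_out by auto
            show "w \<in> V \<Longrightarrow> 2 dvd z'' w" for w
              unfolding z''_def using z'_dvd \<open>b = 2\<close> uV yV by auto
            show "pos_mass V z'' \<le> 2 * int (N - 2)"
              unfolding z''_def using pos_mass_update[of V u y z' "z' u - 4" "z' y + 4"]
                finite_V uV yV uy z'_mass PN u z'y True by simp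
          qed (use finite_V in auto)
          then have "edge_span V (Suc (N - 2)) (\<lambda>w. real_of_int (z' w))"
            using uV yV uy unfolding z''_def by (intro edge_span_transfer)
          then show ?thesis using True by (intro from_z') auto
        qed
      qed
    qed
  qed
qed

text \<open>If neither the positive nor the negative entries contain an exceptional edge without containing a
  regular vertex, then some cut into centered sets separates the positive from the negative entries.\<close>

lemma edge_span_regular: "edge_span V N v"
proof -
  define P where "P = {u \<in> V. v u > 0}"
  define M where "M = {u \<in> V. v u < 0}"
  have sub: "P \<subseteq> V" "M \<subseteq> V" "P \<inter> M = {}" unfolding P_def M_def by auto
  \<comment> \<open>A set that is not exceptional is centered at a regular vertex or at any of its vertices.\<close>
  define exc where "exc S \<longleftrightarrow> S \<inter> G = {} \<and> (\<exists>x\<in>S. \<exists>x'\<in>S. x \<noteq> x' \<and> lam x x' \<noteq> c)" for S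
  have cent: "centered S" if h: "\<not> exc S" "S \<subseteq> V" "S \<noteq> {}" for S
  proof (cases "S \<inter> G = {}")
    case True
    obtain p where "p \<in> S" using h by blast
    have "lam p u = c" if u: "u \<in> S - {p}" for u
    proof (rule ccontr)
      assume "lam p u \<noteq> c"
      moreover have "u \<in> S" "p \<noteq> u" using u by auto
      ultimately have "exc S" unfolding exc_def using True \<open>p \<in> S\<close> by (intro conjI bexI[of _ p] bexI[of _ u]) auto
      then show False using h by simp
    qed
    then show ?thesis using \<open>p \<in> S\<close> h(2) unfolding centered_def by (intro conjI bexI[of _ p]) auto
  next
    case False
    then obtain y where "y \<in> G" "y \<in> S" by blast
    then show ?thesis using h(2) centered_regular[of S y] by simp
  qed
  show ?thesis
  proof (cases "exc P \<or> exc M")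
    case True
    then show ?thesis
    proof
      assume "exc P"
      then obtain x x' where x: "x \<in> P" "x' \<in> P" "x \<noteq> x'" "lam x x' \<noteq> c" "P \<inter> G = {}"
        unfolding exc_def by blast
      have "v y \<le> 0" if "y \<in> G" for y
        using that x(5) G_sub unfolding P_def by fastforce
      then show ?thesis
        using x edge_span_exceptional_edge[of x x'] unfolding P_def by simp
    next
      assume "exc M"
      interpret neg: cut_bounded V lam D N "\<lambda>u. - v u" G c by (rule cut_bounded_minus)
      have "edge_span V N (\<lambda>u. - v u)"
      proof -
        obtain x x' where x: "x \<in> M" "x' \<in> M" "x \<noteq> x'" "lam x x' \<noteq> c" "M \<inter> G = {}"
          using \<open>exc M\<close> unfolding exc_def by blast
        have "- v y \<le> 0" if "y \<in> G" for y
          using that x(5) G_sub unfolding M_def by fastforce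
        then show ?thesis
          using x neg.edge_span_exceptional_edge[of x x'] unfolding M_def by simp
      qed
      then show ?thesis using edge_span_scale[of V N "\<lambda>u. - v u" "-1"] by simp
    qed
  next
    case False
    show ?thesis
    proof (cases "P = {} \<or> M = {}")
      case True
      have "v u = 0" for u
      proof (cases "u \<in> V")
        case uV: True
        have "(\<forall>u\<in>V. - v u \<ge> 0) \<or> (\<forall>u\<in>V. v u \<ge> 0)" 
        proof (cases "P = {}")
          case True
          then have "\<not> v w > 0" if "w \<in> V" for w using that unfolding P_def by blast
          then show ?thesis by (simp add: not_less)
        next
          case False
          then have "M = {}" using True by simp
          then have "\<not> v w < 0" if "w \<in> V" for w using that unfolding M_def by blast
          then show ?thesis by (simp add: not_less)
        qed
        then show ?thesis
        proof
          assume "\<forall>u\<in>V. - v u \<ge> 0"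
          moreover have "(\<Sum>u\<in>V. - v u) = 0" using v_sum by (simp add: sum_negf)
          ultimately have "\<forall>u\<in>V. - v u = 0"
            using finite_V sum_nonneg_eq_0_iff[of V "\<lambda>u. - v u"] by blast
          then show ?thesis using uV by simp
        next
          assume "\<forall>u\<in>V. v u \<ge> 0"
          then show ?thesis using finite_V v_sum uV sum_nonneg_eq_0_iff[of V v] by blast
        qed
      qed (rule v_out)
      then have "v = (\<lambda>_. 0)" by (rule ext)
      then show ?thesis by (simp add: edge_span.zero)
    next
      case nonempty: False
      obtain S where S: "P \<subseteq> S" "S \<subseteq> V" "S \<inter> M = {}" "centered S" "centered (V - S)"
      proof (cases "P \<inter> G = {}")
        case True
        obtain y where "y \<in> G" by (rule other_regular)
        then have "centered (V - P)" using True G_sub by (intro centered_regular[of _ y]) (use sub in auto)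
        then show ?thesis using that[of P] cent[of P] False nonempty sub by auto
      next
        case meets: False
        then obtain y where "y \<in> G" "y \<in> P" by blast
        then have "centered (V - M)" by (intro centered_regular[of _ y]) (use sub in auto)
        moreover have "V - (V - M) = M" using sub by auto
        ultimately show ?thesis using that[of "V - M"] cent[of M] False nonempty sub by auto
      qed
      have "pos_mass V z = sum z S" unfolding pos_mass_eq P_def[symmetric]
      proof (rule sum.mono_neutral_left)
        show "finite S" using S finite_V finite_subset by blast
        show "\<forall>u\<in>S - P. z u = 0"
        proof
          fix u assume "u \<in> S - P"
          then have "u \<in> V" "u \<notin> P" "u \<notin> M" using S by auto
          then have "v u = 0" unfolding P_def M_def by simp
          then show "z u = 0" unfolding z_def by simp
        qed
      qed (use S in auto)
      also have "\<dots> \<le> int N" using z_sum_le[OF S(4,5)] by linarith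
      finally show ?thesis by (rule edge_span_pos_mass)
    qed
  qed
qed

end

theorem (in weighted_clique) edge_span_of_bounded_cuts:
  fixes v :: "'v \<Rightarrow> real"
  assumes "sum v V = 0" "\<And>u. u \<notin> V \<Longrightarrow> v u = 0" "V \<noteq> {}"
    and "\<And>S w w'. S \<subseteq> V \<Longrightarrow> tree_weight lam S w \<Longrightarrow> tree_weight lam (V - S) w' \<Longrightarrow>
          D * w * w' * sum v S \<in> \<int> \<and> \<bar>D * w * w' * sum v S\<bar> \<le> real N"
  shows "edge_span V N v"
proof (cases "N + 2 \<le> card V")
  case True
  obtain G c where G: "G \<subseteq> V" "2 \<le> card G" "card (V - G) \<le> N" "c > 0"
    "\<forall>x\<in>G. \<forall>u\<in>V - {x}. lam x u = c"
    by (rule regular_vertices[OF True])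
  have "cut_bounded V lam D N v G c"
  proof (intro cut_bounded.intro weighted_clique_axioms cut_bounded_axioms.intro)
    fix S w w'
    assume S: "S \<subseteq> V" "tree_weight lam S w" "tree_weight lam (V - S) w'"
    show "D * w * w' * sum v S \<in> \<int>" by (rule conjunct1[OF assms(4)[OF S]])
    show "\<bar>D * w * w' * sum v S\<bar> \<le> real N" by (rule conjunct2[OF assms(4)[OF S]])
  qed (use assms(1,2) G in auto)
  then show ?thesis by (rule cut_bounded.edge_span_regular)
next
  case False
  obtain p where "p \<in> V" using assms(3) by blast
  have "edge_span V (card V - 1) v" by (rule edge_span_star[OF finite_V \<open>p \<in> V\<close> assms(1,2)])
  then show ?thesis by (rule edge_span_mono) (use False in simp)
qed

section \<open>Determinants with rows taken from a tree\<close>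

text \<open>Determinants are taken of lists of rows, and the rows are functions, so that rows can be replaced,
  exchanged and summed by list operations.\<close>

definition row_det :: "nat \<Rightarrow> (nat \<Rightarrow> real) list \<Rightarrow> real" where
  "row_det n xs = det (mat n n (\<lambda>(i, j). (xs ! i) j))"

text \<open>Laplace expansion along one row: the cofactors do not depend on that row.\<close>

lemma row_det_functional:
  assumes "length L + Suc (length R) = n"
  obtains C where "\<And>x. row_det n (L @ x # R) = (\<Sum>j<n. x j * C j)"
proof -
  define M where "M x = mat n n (\<lambda>(i, j). ((L @ x # R) ! i) j)" for x
  have k: "length L < n" using assms by simp
  have "row_det n (L @ x # R) = (\<Sum>j<n. x j * cofactor (M (\<lambda>_. 0)) (length L) j)" for x
  proof -
    have "row_det n (L @ x # R) = (\<Sum>j<n. M x $$ (length L, j) * cofactor (M x) (length L) j)"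
      unfolding row_det_def M_def[symmetric] using k
      by (intro laplace_expansion_row) (auto simp: M_def)
    also have "\<dots> = (\<Sum>j<n. x j * cofactor (M (\<lambda>_. 0)) (length L) j)"
    proof (intro sum.cong refl arg_cong2[of _ _ _ _ "(*)"])
      fix j assume j: "j \<in> {..<n}"
      show "M x $$ (length L, j) = x j" using j k by (simp add: M_def nth_append)
      have "mat_delete (M x) (length L) j = mat_delete (M (\<lambda>_. 0)) (length L) j"
        unfolding mat_delete_def M_def by (rule eq_matI) (use k j in \<open>auto simp: nth_append nth_Cons split: nat.split\<close>)
      then show "cofactor (M x) (length L) j = cofactor (M (\<lambda>_. 0)) (length L) j"
        unfolding cofactor_def by simp
    qed
    finally show ?thesis .
  qed
  then show ?thesis using that by blast
qed

lemma row_det_linear: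
  assumes "length L + Suc (length R) = n"
  shows "row_det n (L @ (\<lambda>j. a * x j + b * y j) # R) = a * row_det n (L @ x # R) + b * row_det n (L @ y # R)"
proof -
  obtain C where C: "\<And>x. row_det n (L @ x # R) = (\<Sum>j<n. x j * C j)"
    using row_det_functional[OF assms] by blast
  show ?thesis unfolding C by (simp add: algebra_simps sum.distrib sum_distrib_left)
qed

lemma row_det_sum:
  assumes "length L + Suc (length R) = n"
  shows "row_det n (L @ (\<lambda>j. \<Sum>u\<in>S. a u * g u j) # R) = (\<Sum>u\<in>S. a u * row_det n (L @ g u # R))"
proof -
  obtain C where C: "\<And>x. row_det n (L @ x # R) = (\<Sum>j<n. x j * C j)"
    using row_det_functional[OF assms] by blast
  have "(\<Sum>j<n. (\<Sum>u\<in>S. a u * g u j) * C j) = (\<Sum>j<n. \<Sum>u\<in>S. a u * (g u j * C j))"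
    by (simp add: sum_distrib_right mult.assoc)
  also have "\<dots> = (\<Sum>u\<in>S. \<Sum>j<n. a u * (g u j * C j))" by (rule sum.swap)
  finally show ?thesis unfolding C by (simp add: sum_distrib_left)
qed

lemma row_det_repeat:
  assumes "length xs = n" "i < n" "j < n" "i \<noteq> j" "xs ! i = xs ! j"
  shows "row_det n xs = 0"
  unfolding row_det_def
  by (rule det_identical_rows[of _ n i j]) (use assms in \<open>auto simp: row_def\<close>)

lemma row_det_swap:
  assumes "length L + Suc (Suc (length R)) = n"
  shows "row_det n (L @ x # y # R) = - row_det n (L @ y # x # R)"
proof -
  let ?s = "\<lambda>j. 1 * x j + 1 * y j"
  have rep: "row_det n (L @ w # w # R) = 0" for w
    by (rule row_det_repeat[of _ _ "length L" "Suc (length L)"]) (use assms in \<open>auto simp: nth_append\<close>)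
  have lin: "row_det n (L @ ?s # w # R) = 1 * row_det n (L @ x # w # R) + 1 * row_det n (L @ y # w # R)" for w
    using assms by (intro row_det_linear) simp
  have lin': "row_det n (L @ w # ?s # R) = 1 * row_det n (L @ w # x # R) + 1 * row_det n (L @ w # y # R)" for w
    using row_det_linear[of "L @ [w]" R n 1 x 1 y] assms by simp
  show ?thesis using rep[of ?s] rep[of x] rep[of y] unfolding lin lin' by simp
qed

definition unit_fun :: "nat \<Rightarrow> nat \<Rightarrow> real" where
  "unit_fun a u = (if u = a then 1 else 0)"

lemma edge_vec_unit: "edge_vec x y = (\<lambda>u. 1 * unit_fun x u + (- 1) * unit_fun y u)"
  by (auto simp: edge_vec_def unit_fun_def)

lemma row_det_edge:
  assumes "length L + Suc (length R) = n"
  shows "row_det n (L @ edge_vec x y # R) = row_det n (L @ unit_fun x # R) - row_det n (L @ unit_fun y # R)"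
  unfolding edge_vec_unit row_det_linear[OF assms] by simp

lemma row_det_scale_list:
  assumes "length L + length es + length R = n"
  shows "row_det n (L @ map (\<lambda>e. \<lambda>u. a e * f e u) es @ R) = prod_list (map a es) * row_det n (L @ map f es @ R)"
  using assms
proof (induction es arbitrary: L)
  case (Cons e es)
  have "row_det n (L @ map (\<lambda>e. \<lambda>u. a e * f e u) (e # es) @ R)
      = a e * row_det n (L @ f e # map (\<lambda>e. \<lambda>u. a e * f e u) es @ R)"
    using row_det_linear[of L "map (\<lambda>e. \<lambda>u. a e * f e u) es @ R" n "a e" "f e" 0 "f e"] Cons.prems by simp
  also have "\<dots> = a e * (prod_list (map a es) * row_det n ((L @ [f e]) @ map f es @ R))"
    using Cons.IH[of "L @ [f e]"] Cons.prems by simp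
  finally show ?case by simp
qed simp

lemma row_det_units:
  assumes "distinct qs" "set qs = {..<n}"
  shows "\<bar>row_det n (map unit_fun qs)\<bar> = 1"
proof -
  have len: "length qs = n" using assms distinct_card by force
  define p where "p i = (if i < n then qs ! i else i)" for i
  have "bij_betw (\<lambda>i. qs ! i) {..<n} {..<n}" using assms len by (intro bij_betw_nth) auto
  then have "bij_betw p {..<n} {..<n}" by (rule bij_betw_cong[THEN iffD1, rotated]) (auto simp: p_def)
  then have p: "p permutes {0..<n}" by (intro bij_imp_permutes) (auto simp: p_def atLeast0LessThan)
  have "row_det n (map unit_fun qs) = det (mat n n (\<lambda>(i, j). (1\<^sub>m n :: real mat) $$ (p i, j)))"
    unfolding row_det_def
    by (intro arg_cong[of _ _ det] eq_matI)
      (use len assms nth_mem[of _ qs] in \<open>auto simp: p_def unit_fun_def\<close>)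
  also have "\<dots> = signof p" using det_permute_rows[OF _ p, of "1\<^sub>m n :: real mat"] by simp
  finally show ?thesis by (simp add: sign_def)
qed

text \<open>Modulo the edges of a tree on \<open>Q\<close>, all unit vectors at vertices of \<open>Q\<close> agree. Hence a unit vector
  next to the edges of the tree can be placed at any vertex of \<open>Q\<close>, and together they have the same
  determinant as all the unit vectors at \<open>Q\<close>.\<close>

lemma tree_edge_list:
  assumes "tree_weight lam Q w"
  shows "\<exists>es qs. distinct qs \<and> set qs = Q \<and> Suc (length es) = card Q \<and>
    (\<forall>(x, y)\<in>set es. x \<in> Q \<and> y \<in> Q \<and> x \<noteq> y) \<and>
    prod_list (map (\<lambda>(x, y). lam x y) es) = w \<and>
    (\<forall>n L R. \<forall>a\<in>Q. length L + card Q + length R = n \<longrightarrow>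
       row_det n (L @ map (\<lambda>(x, y). edge_vec x y) es @ unit_fun a # R) = row_det n (L @ map unit_fun qs @ R))"
  using assms
proof (induction rule: tree_weight.induct)
  case (single x)
  show ?case by (rule exI[of _ "[]"], rule exI[of _ "[x]"]) auto
next
  case (grow Q w y x)
  obtain es qs where IH: "distinct qs" "set qs = Q" "Suc (length es) = card Q"
    "\<forall>(x, y)\<in>set es. x \<in> Q \<and> y \<in> Q \<and> x \<noteq> y"
    "prod_list (map (\<lambda>(x, y). lam x y) es) = w"
    "\<forall>n L R. \<forall>a\<in>Q. length L + card Q + length R = n \<longrightarrow>
       row_det n (L @ map (\<lambda>(x, y). edge_vec x y) es @ unit_fun a # R) = row_det n (L @ map unit_fun qs @ R)"
    using grow.IH by blast
  have finQ: "finite Q" using tree_weight_finite grow.hyps by blast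
  have cardQ: "card (insert x Q) = Suc (card Q)" using finQ grow.hyps by simp
  have lenqs: "length qs = card Q" using IH distinct_card by force
  let ?e = "map (\<lambda>(x, y). edge_vec x y) es"
  show ?case
  proof (rule exI[of _ "es @ [(y, x)]"], rule exI[of _ "qs @ [x]"], intro conjI allI ballI impI)
    fix n a :: nat and L R :: "(nat \<Rightarrow> real) list"
    assume a: "a \<in> insert x Q" and len: "length L + card (insert x Q) + length R = n"
    have at_y: "row_det n (L @ ?e @ unit_fun y # w # R) = row_det n (L @ map unit_fun qs @ w # R)" for w
      using IH(6)[THEN spec[of _ n], THEN spec[of _ L], THEN spec[of _ "w # R"]] grow.hyps len cardQ by simp
    have "row_det n (L @ ?e @ edge_vec y x # unit_fun a # R) = row_det n (L @ map unit_fun qs @ unit_fun x # R)"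
    proof (cases "a = x")
      case True
      have "row_det n ((L @ ?e) @ edge_vec y x # unit_fun x # R) =
        row_det n ((L @ ?e) @ unit_fun y # unit_fun x # R) - row_det n ((L @ ?e) @ unit_fun x # unit_fun x # R)"
        using len IH cardQ by (intro row_det_edge) simp
      moreover have "row_det n ((L @ ?e) @ unit_fun x # unit_fun x # R) = 0"
        using len IH cardQ
        by (intro row_det_repeat[of _ _ "length (L @ ?e)" "Suc (length (L @ ?e))"]) (auto simp: nth_append)
      ultimately show ?thesis using at_y[of "unit_fun x"] True by simp
    next
      case False
      then have aQ: "a \<in> Q" using a by simp
      have "row_det n ((L @ ?e) @ edge_vec y x # unit_fun a # R) = - row_det n ((L @ ?e) @ unit_fun a # edge_vec y x # R)"
        using len IH cardQ by (intro row_det_swap) simp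
      also have "row_det n ((L @ ?e) @ unit_fun a # edge_vec y x # R) = row_det n ((L @ map unit_fun qs) @ edge_vec y x # R)"
        using IH(6)[THEN spec[of _ n], THEN spec[of _ L], THEN spec[of _ "edge_vec y x # R"]] aQ len cardQ by simp
      also have "\<dots> = row_det n ((L @ map unit_fun qs) @ unit_fun y # R) - row_det n ((L @ map unit_fun qs) @ unit_fun x # R)"
        using len lenqs cardQ by (intro row_det_edge) simp
      also have "row_det n ((L @ map unit_fun qs) @ unit_fun y # R) = 0"
      proof -
        obtain i where i: "i < length qs" "qs ! i = y" using grow.hyps IH by (metis in_set_conv_nth)
        show ?thesis
          by (rule row_det_repeat[of _ _ "length L + i" "length L + length qs"])
            (use i len lenqs cardQ in \<open>auto simp: nth_append\<close>)
      qed
      finally show ?thesis by simp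
    qed
    then show "row_det n (L @ map (\<lambda>(x, y). edge_vec x y) (es @ [(y, x)]) @ unit_fun a # R) =
        row_det n (L @ map unit_fun (qs @ [x]) @ R)" by simp
  qed (use IH grow.hyps cardQ in auto)
qed

lemma row_det_last_unit:
  assumes "length xs = k"
  shows "row_det (Suc k) (xs @ [unit_fun k]) = row_det k xs"
proof -
  define M where "M = mat (Suc k) (Suc k) (\<lambda>(i, j). ((xs @ [unit_fun k]) ! i) j)"
  have "row_det (Suc k) (xs @ [unit_fun k]) = (\<Sum>j<Suc k. M $$ (k, j) * cofactor M k j)"
    unfolding row_det_def M_def[symmetric] by (intro laplace_expansion_row) (auto simp: M_def)
  also have "\<dots> = (\<Sum>j<Suc k. if j = k then cofactor M k k else 0)"
    using assms by (intro sum.cong) (auto simp: M_def unit_fun_def nth_append)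
  also have "\<dots> = cofactor M k k" by simp
  finally have expand: "row_det (Suc k) (xs @ [unit_fun k]) = cofactor M k k" .
  have "mat_delete M k k = mat k k (\<lambda>(i, j). (xs ! i) j)"
    unfolding mat_delete_def M_def by (rule eq_matI) (use assms in \<open>auto simp: nth_append\<close>)
  moreover have "(- 1 :: real) ^ (k + k) = 1" by (metis mult_2 power_minus1_even)
  ultimately have "cofactor M k k = row_det k xs"
    unfolding cofactor_def row_det_def by simp
  then show ?thesis using expand by simp
qed

text \<open>Rows are chosen one after the other. If no further row enlarged a nonzero minor of order \<open>k\<close>, then
  the cofactors along that row would be the coefficients of a linear relation among the first \<open>k + 1\<close>
  columns, and the last of these cofactors is the given minor.\<close>

lemma nonzero_minor:
  fixes B :: "nat \<Rightarrow> nat \<Rightarrow> real"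
  assumes indep: "\<And>a. \<forall>i<m. (\<Sum>b<r. a b * B i b) = 0 \<Longrightarrow> \<forall>b<r. a b = 0"
  obtains rs where "length rs = r" "set rs \<subseteq> {..<m}" "row_det r (map B rs) \<noteq> 0"
proof -
  have "\<exists>rs. length rs = k \<and> set rs \<subseteq> {..<m} \<and> row_det k (map B rs) \<noteq> 0" if "k \<le> r" for k
    using that
  proof (induction k)
    case 0
    then show ?case by (intro exI[of _ "[]"]) (simp add: row_det_def)
  next
    case (Suc k)
    then obtain rs where rs: "length rs = k" "set rs \<subseteq> {..<m}" "row_det k (map B rs) \<noteq> 0" by auto
    obtain C where C: "\<And>x. row_det (Suc k) (map B rs @ x # []) = (\<Sum>j<Suc k. x j * C j)"
      using row_det_functional[of "map B rs" "[]" "Suc k"] rs by auto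
    have "(\<Sum>j<Suc k. unit_fun k j * C j) = C k" by (simp add: unit_fun_def)
    then have Ck: "C k \<noteq> 0" using C[of "unit_fun k"] row_det_last_unit[of "map B rs" k] rs by simp
    define a where "a b = (if b < Suc k then C b else 0)" for b
    have "\<not> (\<forall>i<m. (\<Sum>b<r. a b * B i b) = 0)"
    proof
      assume "\<forall>i<m. (\<Sum>b<r. a b * B i b) = 0"
      then have "\<forall>b<r. a b = 0" by (rule indep)
      then have "a k = 0" using Suc.prems by simp
      then show False using Ck by (simp add: a_def)
    qed
    then obtain i where i: "i < m" "(\<Sum>b<r. a b * B i b) \<noteq> 0" by blast
    have "(\<Sum>b<r. a b * B i b) = (\<Sum>b<Suc k. a b * B i b)"
      using Suc.prems by (intro sum.mono_neutral_right) (auto simp: a_def)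
    also have "\<dots> = (\<Sum>b<Suc k. B i b * C b)" by (intro sum.cong) (auto simp: a_def)
    also have "\<dots> = row_det (Suc k) (map B (rs @ [i]))" using C[of "B i"] by simp
    finally show ?case using i rs by (intro exI[of _ "rs @ [i]"]) auto
  qed
  then show ?thesis using that by blast
qed


lemma Ints_abs_eq: "x \<in> \<int>" if "\<bar>x\<bar> = \<bar>y\<bar>" "y \<in> \<int>" for x y :: real
  using that by (metis abs_eq_iff Ints_minus)

text \<open>Here \<open>v\<close> and the edge vectors have length \<open>r + 1\<close> but lie in the hyperplane of sum zero, which is
  why the unit vector at \<open>r\<close> completes \<open>r\<close> of them to a square matrix. The minor at a spanning tree is
  the product of the weights up to sign. The minor at \<open>v\<close>, a tree on \<open>S\<close> and a tree on \<open>V - S\<close> follows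
  by expanding \<open>v\<close> into unit vectors: those on the side of \<open>r\<close> contribute nothing, and those on the
  other side all contribute the same product of weights.\<close>

lemma edge_span_of_minors:
  fixes ell :: "nat \<Rightarrow> nat \<Rightarrow> real" and v :: "nat \<Rightarrow> real" and D :: real and r N :: nat
  defines "V \<equiv> {..r}"
  assumes D: "D \<noteq> 0"
    and ell: "\<And>x y. x \<in> V \<Longrightarrow> y \<in> V \<Longrightarrow> x \<noteq> y \<Longrightarrow> ell x y \<noteq> 0"
    and ell_sym: "\<And>x y. x \<in> V \<Longrightarrow> y \<in> V \<Longrightarrow> \<bar>ell x y\<bar> = \<bar>ell y x\<bar>"
    and v_sum: "sum v V = 0" and v_out: "\<And>u. u \<notin> V \<Longrightarrow> v u = 0"
    and minor: "\<And>xs. length xs = r \<Longrightarrow>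
        (\<And>x. x \<in> set xs \<Longrightarrow> x = v \<or> (\<exists>p\<in>V. \<exists>q\<in>V. p \<noteq> q \<and> x = (\<lambda>u. ell p q * edge_vec p q u))) \<Longrightarrow>
        D * row_det (Suc r) (xs @ [unit_fun r]) \<in> \<int> \<and> \<bar>D * row_det (Suc r) (xs @ [unit_fun r])\<bar> \<le> real N"
  shows "edge_span V N v"
proof -
  define lam where "lam = (\<lambda>x y. \<bar>ell x y\<bar>)"
  define col where "col = (\<lambda>(p, q). \<lambda>u. ell p q * edge_vec p q u)"
  define edg :: "nat \<times> nat \<Rightarrow> nat \<Rightarrow> real" where "edg = (\<lambda>(p, q). edge_vec p q)"
  define wt where "wt es = prod_list (map (\<lambda>(p, q). ell p q) es)" for es
  have finV: "finite V" and cardV: "card V = Suc r" and rV: "r \<in> V" and Vn: "V = {..<Suc r}"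
    unfolding V_def by auto
  have col: "map col es = map (\<lambda>e. \<lambda>u. (\<lambda>(p, q). ell p q) e * edg e u) es" for es
    unfolding col_def edg_def by (auto simp: split_beta)
  have scaled: "row_det n (L @ map col es @ R) = wt es * row_det n (L @ map edg es @ R)"
    if "length L + length es + length R = n" for n L es R
    unfolding col wt_def using that by (intro row_det_scale_list)
  have wt_abs: "\<bar>wt es\<bar> = prod_list (map (\<lambda>(p, q). lam p q) es)" for es
    unfolding wt_def lam_def by (induction es) (auto simp: abs_mult)
  have minor': "D * row_det (Suc r) (xs @ [unit_fun r]) \<in> \<int>"
      "\<bar>D * row_det (Suc r) (xs @ [unit_fun r])\<bar> \<le> real N"
    if "length xs = r" "set xs \<subseteq> insert v (col ` {(p, q). p \<in> V \<and> q \<in> V \<and> p \<noteq> q})" for xs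
  proof -
    have mem: "x = v \<or> (\<exists>p\<in>V. \<exists>q\<in>V. p \<noteq> q \<and> x = (\<lambda>u. ell p q * edge_vec p q u))" if "x \<in> set xs" for x
    proof -
      have "x \<in> insert v (col ` {(p, q). p \<in> V \<and> q \<in> V \<and> p \<noteq> q})"
        using \<open>x \<in> set xs\<close> \<open>set xs \<subseteq> _\<close> by blast
      then show ?thesis unfolding col_def by force
    qed
    show "D * row_det (Suc r) (xs @ [unit_fun r]) \<in> \<int>"
      by (rule conjunct1[OF minor[OF \<open>length xs = r\<close> mem]])
    show "\<bar>D * row_det (Suc r) (xs @ [unit_fun r])\<bar> \<le> real N"
      by (rule conjunct2[OF minor[OF \<open>length xs = r\<close> mem]])
  qed
  have tree: "\<bar>D\<bar> * w \<in> \<int> \<and> \<bar>D\<bar> * w \<le> real N" if w: "tree_weight lam V w" for w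
  proof -
    obtain es qs where es: "distinct qs" "set qs = V" "Suc (length es) = card V"
      "\<forall>(x, y)\<in>set es. x \<in> V \<and> y \<in> V \<and> x \<noteq> y"
      "prod_list (map (\<lambda>(x, y). lam x y) es) = w"
      and det: "\<forall>n L R. \<forall>a\<in>V. length L + card V + length R = n \<longrightarrow>
         row_det n (L @ map edg es @ unit_fun a # R) = row_det n (L @ map unit_fun qs @ R)"
      using tree_edge_list[OF w] unfolding edg_def by blast
    have "row_det (Suc r) (map edg es @ [unit_fun r]) = row_det (Suc r) (map unit_fun qs)"
      using det[THEN spec[of _ "Suc r"], THEN spec[of _ "[]"], THEN spec[of _ "[]"]] rV cardV by simp
    then have "\<bar>row_det (Suc r) (map edg es @ [unit_fun r])\<bar> = 1"
      using row_det_units[of qs "Suc r"] es Vn by simp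
    moreover have "row_det (Suc r) (map col es @ [unit_fun r]) = wt es * row_det (Suc r) (map edg es @ [unit_fun r])"
      using scaled[of "[]" es "[unit_fun r]"] es cardV by simp
    ultimately have eq: "\<bar>D * row_det (Suc r) (map col es @ [unit_fun r])\<bar> = \<bar>D\<bar> * w"
      using wt_abs[of es] es by (simp add: abs_mult)
    have "set (map col es) \<subseteq> insert v (col ` {(p, q). p \<in> V \<and> q \<in> V \<and> p \<noteq> q})"
      using es(4) by auto
    then have "D * row_det (Suc r) (map col es @ [unit_fun r]) \<in> \<int>"
      "\<bar>D * row_det (Suc r) (map col es @ [unit_fun r])\<bar> \<le> real N"
      using minor'[of "map col es"] es cardV by auto
    then show ?thesis unfolding eq[symmetric] by simp
  qed
  have cut_root: "\<bar>D\<bar> * w * w' * sum v S \<in> \<int> \<and> \<bar>\<bar>D\<bar> * w * w' * sum v S\<bar> \<le> real N"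
    if S: "S \<subseteq> V" "r \<notin> S" and w: "tree_weight lam S w" and w': "tree_weight lam (V - S) w'" for S w w'
  proof -
    obtain es qs where es: "distinct qs" "set qs = S" "Suc (length es) = card S"
      "\<forall>(x, y)\<in>set es. x \<in> S \<and> y \<in> S \<and> x \<noteq> y"
      "prod_list (map (\<lambda>(x, y). lam x y) es) = w"
      and det: "\<forall>n L R. \<forall>a\<in>S. length L + card S + length R = n \<longrightarrow>
         row_det n (L @ map edg es @ unit_fun a # R) = row_det n (L @ map unit_fun qs @ R)"
      using tree_edge_list[OF w] unfolding edg_def by blast
    obtain es' qs' where es': "distinct qs'" "set qs' = V - S" "Suc (length es') = card (V - S)"
      "\<forall>(x, y)\<in>set es'. x \<in> V - S \<and> y \<in> V - S \<and> x \<noteq> y"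
      "prod_list (map (\<lambda>(x, y). lam x y) es') = w'"
      and det': "\<forall>n L R. \<forall>a\<in>V - S. length L + card (V - S) + length R = n \<longrightarrow>
         row_det n (L @ map edg es' @ unit_fun a # R) = row_det n (L @ map unit_fun qs' @ R)"
      using tree_edge_list[OF w'] unfolding edg_def by blast
    have "card S + card (V - S) = Suc r"
      using S finV cardV by (metis card_Diff_subset card_mono finite_subset le_add_diff_inverse)
    then have len: "length es + length es' + 2 = Suc r" "card S = Suc (length es)"
        "card (V - S) = Suc (length es')" using es(3) es'(3) by auto
    have lenqs: "length qs' = Suc (length es')" using es'(1,2) len distinct_card[of qs'] by simp
    define q where "q = row_det (Suc r) (map unit_fun (qs @ qs'))"
    have q: "\<bar>q\<bar> = 1" unfolding q_def using es es' S Vn by (intro row_det_units) auto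
    have at: "row_det (Suc r) (map edg es @ unit_fun a # map edg es' @ [unit_fun r]) = (if a \<in> S then q else 0)"
      if a: "a \<in> V" for a
    proof -
      have "row_det (Suc r) (map edg es @ unit_fun a # map edg es' @ [unit_fun r])
          = row_det (Suc r) (map edg es @ unit_fun a # map unit_fun qs')"
        using det'[THEN spec[of _ "Suc r"], THEN spec[of _ "map edg es @ [unit_fun a]"], THEN spec[of _ "[]"]] rV S len by simp
      also have "\<dots> = (if a \<in> S then q else 0)"
      proof (cases "a \<in> S")
        case True
        then show ?thesis
          using det[THEN spec[of _ "Suc r"], THEN spec[of _ "[]"], THEN spec[of _ "map unit_fun qs'"]] len lenqs unfolding q_def by simp
      next
        case False
        then obtain i where i: "i < length qs'" "qs' ! i = a" using a es'(2) by (metis Diff_iff in_set_conv_nth)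
        have "row_det (Suc r) (map edg es @ unit_fun a # map unit_fun qs') = 0"
          by (rule row_det_repeat[of _ _ "length es" "length es + Suc i"])
            (use i len lenqs in \<open>auto simp: nth_append\<close>)
        then show ?thesis using False by simp
      qed
      finally show ?thesis .
    qed
    have v_eq: "v = (\<lambda>j. \<Sum>u\<in>V. v u * unit_fun u j)"
    proof
      fix j
      have "(\<Sum>u\<in>V. v u * unit_fun u j) = (\<Sum>u\<in>V. if j = u then v u else 0)"
        by (intro sum.cong) (auto simp: unit_fun_def)
      then show "v j = (\<Sum>u\<in>V. v u * unit_fun u j)" using finV v_out by simp
    qed
    have "row_det (Suc r) (map edg es @ v # map edg es' @ [unit_fun r])
        = (\<Sum>a\<in>V. v a * row_det (Suc r) (map edg es @ unit_fun a # map edg es' @ [unit_fun r]))"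
      by (subst v_eq, rule row_det_sum) (use len in simp)
    also have "\<dots> = (\<Sum>a\<in>V. if a \<in> S then q * v a else 0)"
      using at by (intro sum.cong) auto
    also have "\<dots> = q * sum v S"
      using S finV by (simp add: sum.inter_restrict[symmetric] Int_absorb1 sum_distrib_left)
    finally have det_edg: "row_det (Suc r) (map edg es @ v # map edg es' @ [unit_fun r]) = q * sum v S" .
    have "row_det (Suc r) (map col es @ v # map col es' @ [unit_fun r])
        = wt es * row_det (Suc r) ((map edg es @ [v]) @ map col es' @ [unit_fun r])"
      using scaled[of "[]" es "v # map col es' @ [unit_fun r]" "Suc r"] len by simp
    also have "\<dots> = wt es * (wt es' * (q * sum v S))"
      using scaled[of "map edg es @ [v]" es' "[unit_fun r]" "Suc r"] len det_edg by simp
    finally have eq: "\<bar>D * row_det (Suc r) ((map col es @ v # map col es') @ [unit_fun r])\<bar> = \<bar>\<bar>D\<bar> * w * w' * sum v S\<bar>"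
      using wt_abs[of es] wt_abs[of es'] es(5) es'(5) q
      by (simp add: abs_mult)
    have "set es \<subseteq> {(p, q). p \<in> V \<and> q \<in> V \<and> p \<noteq> q}" using es(4) S by auto
    moreover have "set es' \<subseteq> {(p, q). p \<in> V \<and> q \<in> V \<and> p \<noteq> q}" using es'(4) by auto
    ultimately have "set (map col es @ v # map col es') \<subseteq> insert v (col ` {(p, q). p \<in> V \<and> q \<in> V \<and> p \<noteq> q})"
      by auto
    moreover have "length (map col es @ v # map col es') = r" using len by simp
    ultimately have "D * row_det (Suc r) ((map col es @ v # map col es') @ [unit_fun r]) \<in> \<int>"
      "\<bar>D * row_det (Suc r) ((map col es @ v # map col es') @ [unit_fun r])\<bar> \<le> real N"
      using minor' by blast+
    then show ?thesis using Ints_abs_eq[OF eq[symmetric]] unfolding eq by blast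
  qed
  have "weighted_clique V lam \<bar>D\<bar> N"
  proof unfold_locales
    show "lam x y > 0" if "x \<in> V" "y \<in> V" "x \<noteq> y" for x y unfolding lam_def using ell[OF that] by simp
    show "lam x y = lam y x" if "x \<in> V" "y \<in> V" for x y unfolding lam_def using ell_sym[OF that] .
    show "\<bar>D\<bar> * w \<in> \<int>" "\<bar>D\<bar> * w \<le> real N" if "tree_weight lam V w" for w
      using tree[OF that] by (simp_all)
  qed (use finV D in auto)
  then show ?thesis
  proof (rule weighted_clique.edge_span_of_bounded_cuts)
    show "V \<noteq> {}" using rV by auto
    fix S w w'
    assume S: "S \<subseteq> V" and w: "tree_weight lam S w" "tree_weight lam (V - S) w'"
    show "\<bar>D\<bar> * w * w' * sum v S \<in> \<int> \<and> \<bar>\<bar>D\<bar> * w * w' * sum v S\<bar> \<le> real N"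
    proof (cases "r \<in> S")
      case False
      then show ?thesis using cut_root[OF S _ w] by simp
    next
      case True
      have "sum v (V - S) = - sum v S" using S finV v_sum by (simp add: sum_diff)
      moreover have "V - (V - S) = S" using S by auto
      ultimately have "\<bar>D\<bar> * w' * w * - sum v S \<in> \<int> \<and> \<bar>\<bar>D\<bar> * w' * w * - sum v S\<bar> \<le> real N"
        using cut_root[of "V - S" w' w] True w by auto
      then show ?thesis by (simp add: mult_ac)
    qed
  qed (use v_sum v_out in auto)
qed

section \<open>Minors and ranks of submatrices\<close>

lemma distinct_pick_permutation:
  assumes "distinct xs" "length xs = k"
  obtains p where "p permutes {0..<k}" "\<And>a. a < k \<Longrightarrow> xs ! a = pick (set xs) (p a)"
proof -
  let ?I = "set xs"
  define p where "p a = (if a < k then card {c \<in> ?I. c < xs ! a} else a)" for a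
  have pick: "xs ! a = pick ?I (p a)" if "a < k" for a
    using that assms pick_card_in_set[of "xs ! a" ?I] unfolding p_def by simp
  have less: "p a < k" if "a < k" for a
  proof -
    have "{c \<in> ?I. c < xs ! a} \<subset> ?I" using that assms nth_mem[of a xs] by blast
    then have "card {c \<in> ?I. c < xs ! a} < card ?I" by (intro psubset_card_mono) auto
    then show ?thesis using that assms by (simp add: p_def distinct_card)
  qed
  have "inj_on p {0..<k}"
    by (rule inj_onI) (use pick assms in \<open>metis atLeastLessThan_iff nth_eq_iff_index_eq\<close>)
  moreover have "p ` {0..<k} \<subseteq> {0..<k}" using less by auto
  ultimately have "bij_betw p {0..<k} {0..<k}"
    by (simp add: bij_betw_def card_image card_subset_eq)
  then have "p permutes {0..<k}" by (intro bij_imp_permutes) (auto simp: p_def)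
  then show ?thesis using that pick by blast
qed

text \<open>The order in which rows and columns are listed affects only the sign.\<close>

lemma det_submatrix_lists:
  fixes A :: "int mat"
  assumes rows: "distinct rs" "length rs = k" "set rs \<subseteq> {..<dim_row A}"
    and cols: "distinct js" "length js = k" "set js \<subseteq> {..<dim_col A}"
  shows "\<bar>det (mat k k (\<lambda>(a, b). A $$ (rs ! a, js ! b)))\<bar> = \<bar>det (submatrix A (set rs) (set js))\<bar>"
proof -
  obtain p where p: "p permutes {0..<k}" "\<And>a. a < k \<Longrightarrow> rs ! a = pick (set rs) (p a)"
    using distinct_pick_permutation rows by blast
  obtain q where q: "q permutes {0..<k}" "\<And>a. a < k \<Longrightarrow> js ! a = pick (set js) (q a)"
    using distinct_pick_permutation cols by blast
  have cI: "{i. i < dim_row A \<and> i \<in> set rs} = set rs" "{j. j < dim_col A \<and> j \<in> set js} = set js"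
    using rows cols by auto
  have card: "card (set rs) = k" "card (set js) = k"
    using distinct_card[OF rows(1)] distinct_card[OF cols(1)] rows(2) cols(2) by auto
  define S where "S = submatrix A (set rs) (set js)"
  have S: "S \<in> carrier_mat k k" unfolding S_def by (intro carrier_matI) (simp_all add: dim_submatrix cI card)
  have Sij: "S $$ (a, b) = A $$ (pick (set rs) a, pick (set js) b)" if "a < k" "b < k" for a b
    unfolding S_def using that by (subst submatrix_index) (simp_all add: cI card)
  define T where "T = mat k k (\<lambda>(b, a). (S\<^sup>T) $$ (q b, a))"
  have T: "T \<in> carrier_mat k k" unfolding T_def by simp
  have pk: "p a < k" "q a < k" if "a < k" for a
    using that permutes_in_image[OF p(1), of a] permutes_in_image[OF q(1), of a] by auto
  have "det T = signof q * det (S\<^sup>T)" unfolding T_def using S q(1) by (intro det_permute_rows) auto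
  then have detT: "\<bar>det T\<bar> = \<bar>det S\<bar>" using det_transpose[OF S] by (simp add: abs_mult sign_def)
  have "det (mat k k (\<lambda>(a, b). (T\<^sup>T) $$ (p a, b))) = signof p * det (T\<^sup>T)"
    using T p(1) by (intro det_permute_rows) auto
  moreover have "mat k k (\<lambda>(a, b). (T\<^sup>T) $$ (p a, b)) = mat k k (\<lambda>(a, b). A $$ (rs ! a, js ! b))"
    by (rule eq_matI) (use S pk p q Sij in \<open>auto simp: T_def\<close>)
  ultimately show ?thesis using detT det_transpose[OF T] unfolding S_def by (simp add: abs_mult sign_def)
qed

lemma full_col_rank_iff:
  fixes B :: "real mat"
  assumes B: "B \<in> carrier_mat n nc"
  shows "vec_space.rank n B = nc \<longleftrightarrow> (\<forall>v\<in>carrier_vec nc. B *\<^sub>v v = 0\<^sub>v n \<longrightarrow> v = 0\<^sub>v nc)"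
proof
  interpret vec_space "TYPE(real)" n .
  assume rank: "vec_space.rank n B = nc"
  have "distinct (cols B)"
  proof (rule ccontr)
    assume "\<not> distinct (cols B)"
    then have "card (set (cols B)) \<noteq> length (cols B)" using card_distinct by blast
    then have less: "card (set (cols B)) < nc" using card_length[of "cols B"] B by simp
    obtain S where S: "maximal S (\<lambda>T. T \<subseteq> set (cols B) \<and> lin_indpt T)"
      using maximal_exists[of "(\<lambda>T. T \<subseteq> set (cols B) \<and> lin_indpt T)" "card (set (cols B))" "{}"]
      by (meson List.finite_set card_mono empty_iff empty_subsetI finite_lin_indpt2 rev_finite_subset)
    then have "card S \<le> card (set (cols B))" by (simp add: card_mono maximal_def)
    then show False using rank_card_indpt[OF B S] rank less by simp
  qed
  note dist = this
  show "\<forall>v\<in>carrier_vec nc. B *\<^sub>v v = 0\<^sub>v n \<longrightarrow> v = 0\<^sub>v nc"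
  proof (intro ballI impI)
    fix v assume v: "v \<in> carrier_vec nc" "B *\<^sub>v v = 0\<^sub>v n"
    show "v = 0\<^sub>v nc"
    proof (rule ccontr)
      assume "v \<noteq> 0\<^sub>v nc"
      then have "lin_dep (set (cols B))" by (rule lin_depI[OF B v(1) _ v(2) dist])
      then show False using full_rank_lin_indpt[OF B rank dist] by simp
    qed
  qed
next
  interpret vec_space "TYPE(real)" n .
  assume ker: "\<forall>v\<in>carrier_vec nc. B *\<^sub>v v = 0\<^sub>v n \<longrightarrow> v = 0\<^sub>v nc"
  have dist: "distinct (cols B)"
  proof (rule ccontr)
    assume "\<not> distinct (cols B)"
    then obtain i j where ij: "i < nc" "j < nc" "i \<noteq> j" "col B i = col B j"
      using B unfolding distinct_conv_nth by (auto simp: cols_nth)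
    have unit: "B *\<^sub>v unit_vec nc k = col B k" if "k < nc" for k
      by (rule eq_vecI) (use B that in auto)
    have "B *\<^sub>v (unit_vec nc i - unit_vec nc j) = B *\<^sub>v unit_vec nc i - B *\<^sub>v unit_vec nc j"
      using B by (intro mult_minus_distrib_mat_vec) auto
    also have "\<dots> = col B i - col B j" unfolding unit[OF ij(1)] unit[OF ij(2)] ..
    also have "\<dots> = 0\<^sub>v n" by (rule eq_vecI) (use B ij in \<open>auto simp del: index_col\<close>)
    finally have "B *\<^sub>v (unit_vec nc i - unit_vec nc j) = 0\<^sub>v n" .
    moreover have "unit_vec nc i - unit_vec nc j \<in> (carrier_vec nc :: real vec set)" by simp
    ultimately have "unit_vec nc i - unit_vec nc j = (0\<^sub>v nc :: real vec)" using ker by blast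
    then have "(unit_vec nc i - unit_vec nc j) $ i = (0\<^sub>v nc :: real vec) $ i" by simp
    then show False using ij by (simp add: unit_vec_def)
  qed
  have "lin_indpt (set (cols B))"
  proof
    assume "lin_dep (set (cols B))"
    then obtain v where "v \<in> carrier_vec nc" "v \<noteq> 0\<^sub>v nc" "B *\<^sub>v v = 0\<^sub>v n"
      by (rule lin_depE[OF B _ dist])
    then show False using ker by blast
  qed
  then show "vec_space.rank n B = nc" using lin_indpt_full_rank[OF B dist] by simp
qed

lemma submatrix_real:
  fixes A :: "int mat"
  assumes J: "J \<subseteq> {..<dim_col A}"
  defines "B \<equiv> map_mat real_of_int (submatrix A UNIV J)"
  shows "B \<in> carrier_mat (dim_row A) (card J)"
    and "\<And>v i. v \<in> carrier_vec (card J) \<Longrightarrow> i < dim_row A \<Longrightarrow>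
      (B *\<^sub>v v) $ i = (\<Sum>b<card J. v $ b * real_of_int (A $$ (i, pick J b)))"
    and "bij_betw (pick J) {..<card J} J"
proof -
  have cJ: "{j. j < dim_col A \<and> j \<in> J} = J" using J by auto
  show B: "B \<in> carrier_mat (dim_row A) (card J)"
    unfolding B_def by (intro carrier_matI) (simp_all add: dim_submatrix cJ)
  show "(B *\<^sub>v v) $ i = (\<Sum>b<card J. v $ b * real_of_int (A $$ (i, pick J b)))"
    if v: "v \<in> carrier_vec (card J)" and i: "i < dim_row A" for v i
  proof -
    have "(B *\<^sub>v v) $ i = (\<Sum>b<card J. B $$ (i, b) * v $ b)"
      using v i B by (simp add: scalar_prod_def atLeast0LessThan)
    also have "\<dots> = (\<Sum>b<card J. v $ b * real_of_int (A $$ (i, pick J b)))"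
    proof (intro sum.cong refl)
      fix b assume b: "b \<in> {..<card J}"
      have "B $$ (i, b) = real_of_int (submatrix A UNIV J $$ (i, b))"
        unfolding B_def using i b by (subst index_map_mat) (simp_all add: dim_submatrix cJ)
      also have "submatrix A UNIV J $$ (i, b) = A $$ (i, pick J b)"
        using i b by (subst submatrix_index) (simp_all add: cJ pick_UNIV)
      finally show "B $$ (i, b) * v $ b = v $ b * real_of_int (A $$ (i, pick J b))" by simp
    qed
    finally show ?thesis .
  qed
  have finJ: "finite J" using J finite_subset by blast
  have "inj_on (pick J) {..<card J}"
  proof (rule inj_onI)
    fix a b assume "a \<in> {..<card J}" "b \<in> {..<card J}" "pick J a = pick J b"
    then show "a = b" using pick_mono_le[of b J a] pick_mono_le[of a J b] by (cases a b rule: linorder_cases) auto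
  qed
  moreover have "pick J ` {..<card J} \<subseteq> J" using pick_in_set_le by auto
  ultimately show "bij_betw (pick J) {..<card J} J"
    using finJ by (simp add: bij_betw_def card_image card_subset_eq)
qed

lemma real_rank_full_iff:
  fixes A :: "int mat"
  assumes J: "J \<subseteq> {..<dim_col A}"
  shows "real_rank (submatrix A UNIV J) = card J \<longleftrightarrow>
    (\<forall>a. (\<forall>i<dim_row A. (\<Sum>j\<in>J. a j * real_of_int (A $$ (i, j))) = 0) \<longrightarrow> (\<forall>j\<in>J. a j = 0))"
proof -
  define B where "B = map_mat real_of_int (submatrix A UNIV J)"
  note B = submatrix_real[OF J, folded B_def]
  have dr: "dim_row (submatrix A UNIV J) = dim_row A" by (simp add: dim_submatrix)
  define h where "h = inv_into {..<card J} (pick J)"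
  have h: "h j < card J" "pick J (h j) = j" if "j \<in> J" for j
    using that B(3) unfolding h_def
    by (metis bij_betw_imp_surj_on inv_into_into lessThan_iff, metis bij_betw_imp_surj_on f_inv_into_f)
  have hp: "h (pick J b) = b" if "b < card J" for b
    using that B(3) unfolding h_def by (simp add: bij_betw_inv_into_left)
  have pJ: "pick J b \<in> J" if "b < card J" for b using that pick_in_set_le by blast
  have "real_rank (submatrix A UNIV J) = card J \<longleftrightarrow>
      (\<forall>v\<in>carrier_vec (card J). B *\<^sub>v v = 0\<^sub>v (dim_row A) \<longrightarrow> v = 0\<^sub>v (card J))"
    unfolding real_rank_def dr B_def[symmetric] by (rule full_col_rank_iff[OF B(1)])
  also have "\<dots> \<longleftrightarrow>
    (\<forall>a. (\<forall>i<dim_row A. (\<Sum>j\<in>J. a j * real_of_int (A $$ (i, j))) = 0) \<longrightarrow> (\<forall>j\<in>J. a j = 0))"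
  proof (intro iffI allI impI ballI)
    fix a j
    assume ker: "\<forall>v\<in>carrier_vec (card J). B *\<^sub>v v = 0\<^sub>v (dim_row A) \<longrightarrow> v = 0\<^sub>v (card J)"
      and rel: "\<forall>i<dim_row A. (\<Sum>j\<in>J. a j * real_of_int (A $$ (i, j))) = 0" and j: "j \<in> J"
    define v where "v = vec (card J) (\<lambda>b. a (pick J b))"
    have v: "v \<in> carrier_vec (card J)" unfolding v_def by simp
    have "B *\<^sub>v v = 0\<^sub>v (dim_row A)"
    proof (rule eq_vecI)
      fix i assume i: "i < dim_vec (0\<^sub>v (dim_row A) :: real vec)"
      then have "(B *\<^sub>v v) $ i = (\<Sum>b<card J. a (pick J b) * real_of_int (A $$ (i, pick J b)))"
        using B(2)[OF v] by (simp add: v_def)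
      also have "\<dots> = (\<Sum>j\<in>J. a j * real_of_int (A $$ (i, j)))"
        by (rule sum.reindex_bij_betw[OF B(3)])
      finally show "(B *\<^sub>v v) $ i = 0\<^sub>v (dim_row A) $ i" using rel i by simp
    qed (use B(1) in simp)
    then have "v = 0\<^sub>v (card J)" using ker v by blast
    then have "v $ h j = 0" using h[OF j] by simp
    then show "a j = 0" using h[OF j] unfolding v_def by simp
  next
    fix v :: "real vec"
    assume rel: "\<forall>a. (\<forall>i<dim_row A. (\<Sum>j\<in>J. a j * real_of_int (A $$ (i, j))) = 0) \<longrightarrow> (\<forall>j\<in>J. a j = 0)"
      and v: "v \<in> carrier_vec (card J)" and z: "B *\<^sub>v v = 0\<^sub>v (dim_row A)"
    have rel': "(\<Sum>j\<in>J. v $ h j * real_of_int (A $$ (i, j))) = 0" if i: "i < dim_row A" for i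
    proof -
      have "(\<Sum>j\<in>J. v $ h j * real_of_int (A $$ (i, j)))
          = (\<Sum>b<card J. v $ h (pick J b) * real_of_int (A $$ (i, pick J b)))"
        by (rule sum.reindex_bij_betw[OF B(3), symmetric])
      also have "\<dots> = (\<Sum>b<card J. v $ b * real_of_int (A $$ (i, pick J b)))"
        using hp by (intro sum.cong) auto
      also have "\<dots> = (B *\<^sub>v v) $ i" using B(2)[OF v i] by simp
      finally show ?thesis using z i by simp
    qed
    have "\<forall>j\<in>J. v $ h j = 0"
      by (rule mp[OF rel[THEN spec[of _ "\<lambda>j. v $ h j"]]]) (intro allI impI rel')
    then have zero: "v $ h j = 0" if "j \<in> J" for j using that by (rule bspec)
    show "v = 0\<^sub>v (card J)"
    proof (rule eq_vecI)
      fix b assume "b < dim_vec (0\<^sub>v (card J) :: real vec)"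
      then have b: "b < card J" by simp
      have "v $ h (pick J b) = 0" by (rule zero[OF pJ[OF b]])
      then show "v $ b = 0\<^sub>v (card J) $ b" unfolding hp[OF b] using b by simp
    qed (use v in simp)
  qed
  finally show ?thesis .
qed

lemma submatrix_image:
  fixes A :: "int mat"
  assumes K: "K \<subseteq> {..<dim_col A}"
  defines "B \<equiv> map_mat real_of_int (submatrix A UNIV K)"
  shows "{y \<in> carrier_vec (dim_row B). \<exists>x\<in>carrier_vec (dim_col B). B *\<^sub>v x = y}
    = {y \<in> carrier_vec (dim_row A). \<exists>a. \<forall>i<dim_row A. y $ i = (\<Sum>j\<in>K. a j * real_of_int (A $$ (i, j)))}"
proof -
  note B = submatrix_real[OF K, folded B_def]
  have dims: "dim_row B = dim_row A" "dim_col B = card K" using B(1) by auto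
  define h where "h = inv_into {..<card K} (pick K)"
  have hp: "h (pick K b) = b" if "b < card K" for b
    unfolding h_def by (rule bij_betw_inv_into_left[OF B(3)]) (use that in simp)
  have iff: "(\<exists>x\<in>carrier_vec (card K). B *\<^sub>v x = y) \<longleftrightarrow>
      (\<exists>a. \<forall>i<dim_row A. y $ i = (\<Sum>j\<in>K. a j * real_of_int (A $$ (i, j))))"
    if y: "y \<in> carrier_vec (dim_row A)" for y
  proof
    assume "\<exists>x\<in>carrier_vec (card K). B *\<^sub>v x = y"
    then obtain x where x: "x \<in> carrier_vec (card K)" "B *\<^sub>v x = y" by blast
    have "y $ i = (\<Sum>j\<in>K. x $ h j * real_of_int (A $$ (i, j)))" if i: "i < dim_row A" for i
    proof -
      have "(\<Sum>j\<in>K. x $ h j * real_of_int (A $$ (i, j)))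
          = (\<Sum>b<card K. x $ h (pick K b) * real_of_int (A $$ (i, pick K b)))"
        by (rule sum.reindex_bij_betw[OF B(3), symmetric])
      also have "\<dots> = (\<Sum>b<card K. x $ b * real_of_int (A $$ (i, pick K b)))"
        using hp by (intro sum.cong) auto
      finally show ?thesis using B(2)[OF x(1) i] x(2) by simp
    qed
    then show "\<exists>a. \<forall>i<dim_row A. y $ i = (\<Sum>j\<in>K. a j * real_of_int (A $$ (i, j)))"
      by (intro exI[of _ "\<lambda>j. x $ h j"] allI impI)
  next
    assume "\<exists>a. \<forall>i<dim_row A. y $ i = (\<Sum>j\<in>K. a j * real_of_int (A $$ (i, j)))"
    then obtain a where a: "\<forall>i<dim_row A. y $ i = (\<Sum>j\<in>K. a j * real_of_int (A $$ (i, j)))" ..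
    define x where "x = vec (card K) (\<lambda>b. a (pick K b))"
    have x: "x \<in> carrier_vec (card K)" unfolding x_def by simp
    have "B *\<^sub>v x = y"
    proof (rule eq_vecI)
      show "dim_vec (B *\<^sub>v x) = dim_vec y" using dims y by simp
      fix i assume "i < dim_vec y"
      then have i: "i < dim_row A" using y by simp
      then have "(B *\<^sub>v x) $ i = (\<Sum>b<card K. a (pick K b) * real_of_int (A $$ (i, pick K b)))"
        using B(2)[OF x i] by (simp add: x_def)
      also have "\<dots> = (\<Sum>j\<in>K. a j * real_of_int (A $$ (i, j)))"
        by (rule sum.reindex_bij_betw[OF B(3)])
      finally show "(B *\<^sub>v x) $ i = y $ i" using a i by simp
    qed
    then show "\<exists>x\<in>carrier_vec (card K). B *\<^sub>v x = y" using x by blast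
  qed
  show ?thesis unfolding dims
  proof (rule Collect_cong, rule conj_cong[OF refl])
    fix y :: "real vec" assume "y \<in> carrier_vec (dim_row A)"
    then show "(\<exists>x\<in>carrier_vec (card K). B *\<^sub>v x = y) \<longleftrightarrow>
      (\<exists>a. \<forall>i<dim_row A. y $ i = (\<Sum>j\<in>K. a j * real_of_int (A $$ (i, j))))" by (rule iff)
  qed
qed

text \<open>The rank depends only on the column space, which does not grow.\<close>

lemma real_rank_cong_span:
  fixes A :: "int mat"
  assumes J: "insert t J \<subseteq> {..<dim_col A}"
    and comb: "\<And>i. i < dim_row A \<Longrightarrow> real_of_int (A $$ (i, t)) = (\<Sum>j\<in>J. c j * real_of_int (A $$ (i, j)))"
  shows "real_rank (submatrix A UNIV (insert t J)) = real_rank (submatrix A UNIV J)"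
proof -
  have finJ: "finite J" using J finite_subset by auto
  have eq: "(\<exists>a. \<forall>i<dim_row A. y $ i = (\<Sum>j\<in>insert t J. a j * real_of_int (A $$ (i, j)))) \<longleftrightarrow>
      (\<exists>a. \<forall>i<dim_row A. y $ i = (\<Sum>j\<in>J. a j * real_of_int (A $$ (i, j))))" for y :: "real vec"
  proof (cases "t \<in> J")
    case True
    then show ?thesis by (simp add: insert_absorb)
  next
    case False
    show ?thesis
    proof
      assume "\<exists>a. \<forall>i<dim_row A. y $ i = (\<Sum>j\<in>insert t J. a j * real_of_int (A $$ (i, j)))"
      then obtain a where a: "\<forall>i<dim_row A. y $ i = (\<Sum>j\<in>insert t J. a j * real_of_int (A $$ (i, j)))" by blast
      have "y $ i = (\<Sum>j\<in>J. (a j + a t * c j) * real_of_int (A $$ (i, j)))" if i: "i < dim_row A" for i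
      proof -
        have "y $ i = a t * real_of_int (A $$ (i, t)) + (\<Sum>j\<in>J. a j * real_of_int (A $$ (i, j)))"
          using a i False finJ by simp
        also have "\<dots> = (\<Sum>j\<in>J. (a j + a t * c j) * real_of_int (A $$ (i, j)))"
          unfolding comb[OF i] by (simp add: algebra_simps sum.distrib sum_distrib_left)
        finally show ?thesis .
      qed
      then show "\<exists>a. \<forall>i<dim_row A. y $ i = (\<Sum>j\<in>J. a j * real_of_int (A $$ (i, j)))"
        by (intro exI[of _ "\<lambda>j. a j + a t * c j"]) simp
    next
      assume "\<exists>a. \<forall>i<dim_row A. y $ i = (\<Sum>j\<in>J. a j * real_of_int (A $$ (i, j)))"
      then obtain a where a: "\<forall>i<dim_row A. y $ i = (\<Sum>j\<in>J. a j * real_of_int (A $$ (i, j)))" by blast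
      have "y $ i = (\<Sum>j\<in>insert t J. (a(t := 0)) j * real_of_int (A $$ (i, j)))" if i: "i < dim_row A" for i
      proof -
        have "(\<Sum>j\<in>J. (a(t := 0)) j * real_of_int (A $$ (i, j))) = (\<Sum>j\<in>J. a j * real_of_int (A $$ (i, j)))"
          using False by (intro sum.cong) auto
        then show ?thesis using a i False finJ by simp
      qed
      then show "\<exists>a. \<forall>i<dim_row A. y $ i = (\<Sum>j\<in>insert t J. a j * real_of_int (A $$ (i, j)))" by blast
    qed
  qed
  have dr: "dim_row (submatrix A UNIV K) = dim_row A" for K by (simp add: dim_submatrix)
  interpret vec_space "TYPE(real)" "dim_row A" .
  have J': "J \<subseteq> {..<dim_col A}" using J by simp
  have "col_space (map_mat real_of_int (submatrix A UNIV (insert t J)))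
      = col_space (map_mat real_of_int (submatrix A UNIV J))"
    unfolding col_space_eq[OF submatrix_real(1)[OF J]] col_space_eq[OF submatrix_real(1)[OF J']]
      submatrix_image[OF J] submatrix_image[OF J'] eq ..
  then have "rank (map_mat real_of_int (submatrix A UNIV (insert t J)))
      = rank (map_mat real_of_int (submatrix A UNIV J))"
    unfolding rank_def col_space_def by (rule arg_cong[where f = "\<lambda>W. vectorspace.dim class_ring (vs W)"])
  then show ?thesis unfolding real_rank_def dr .
qed

section \<open>Matroid ranks and cycles of complete graphs\<close>

lemma (in matroid) rank_of_eq_card_iff:
  assumes "S \<subseteq> ground M"
  shows "rank_of M S = card S \<longleftrightarrow> S \<in> indep M"
proof -
  have finS: "finite S" using assms finite_ground finite_subset by blast
  define C where "C = {I \<in> indep M. I \<subseteq> S}"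
  have "C \<subseteq> Pow S" unfolding C_def by blast
  then have fin: "finite (card ` C)" using finS by (simp add: finite_subset)
  have ne: "card ` C \<noteq> {}" using indep_empty unfolding C_def by blast
  have rank: "rank_of M S = Max (card ` C)" unfolding rank_of_def C_def ..
  show ?thesis
  proof
    assume "rank_of M S = card S"
    then have "card S \<in> card ` C" using Max_in[OF fin ne] unfolding rank by simp
    then obtain I where "I \<in> C" "card S = card I" by (rule imageE)
    moreover from this have "I = S" using card_subset_eq[OF finS, of I] unfolding C_def by simp
    ultimately show "S \<in> indep M" unfolding C_def by simp
  next
    assume "S \<in> indep M"
    then have "S \<in> C" unfolding C_def by simp
    show "rank_of M S = card S" unfolding rank
    proof (rule Max_eqI[OF fin])
      fix k assume "k \<in> card ` C"
      then obtain I where "I \<in> C" "k = card I" by (rule imageE)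
      then show "k \<le> card S" using card_mono[OF finS, of I] unfolding C_def by simp
    qed (use \<open>S \<in> C\<close> in simp)
  qed
qed

lemma (in matroid) card_indep_le_rank:
  assumes "I \<in> indep M"
  shows "card I \<le> matroid_rank M"
proof -
  define C where "C = {I \<in> indep M. I \<subseteq> ground M}"
  have "C \<subseteq> Pow (ground M)" unfolding C_def by blast
  then have "finite (card ` C)" using finite_ground by (simp add: finite_subset)
  moreover have "I \<in> C" unfolding C_def using assms indep_subset[OF assms] by simp
  ultimately show ?thesis unfolding matroid_rank_def rank_of_def C_def[symmetric] by simp
qed


text \<open>The first three edges of a cycle are distinct.\<close>

lemma three_le_card_cycle:
  assumes "is_cycle F vs" "finite F"
  shows "3 \<le> card F"
proof -
  have len: "3 \<le> length vs" and dist: "distinct vs"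
    and edge: "\<And>i. i < length vs \<Longrightarrow> {vs ! i, vs ! (Suc i mod length vs)} \<in> F"
    using assms unfolding is_cycle_def by auto
  have "vs \<noteq> []" using len by auto
  define k where "k = 3 mod length vs"
  have k: "k < length vs" "k \<noteq> 1" "k \<noteq> 2"
    using len unfolding k_def by (cases "length vs = 3"; simp)+
  have edges: "{vs ! 0, vs ! 1} \<in> F" "{vs ! 1, vs ! 2} \<in> F" "{vs ! 2, vs ! k} \<in> F"
    using edge[of 0] edge[of 1] edge[of 2] len \<open>vs \<noteq> []\<close> unfolding k_def
    by (simp_all add: numeral_2_eq_2 numeral_3_eq_3)
  have eq: "vs ! i \<noteq> vs ! j" if "i < length vs" "j < length vs" "i \<noteq> j" for i j
    using that dist nth_eq_iff_index_eq by blast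
  have ne: "vs ! 0 \<noteq> vs ! 1" "vs ! 0 \<noteq> vs ! 2" "vs ! 1 \<noteq> vs ! 2" "vs ! 1 \<noteq> vs ! k" "vs ! 2 \<noteq> vs ! k"
    using k len \<open>vs \<noteq> []\<close> by (intro eq; simp)+
  have "{vs ! 0, vs ! 1} \<noteq> {vs ! 1, vs ! 2}" "{vs ! 0, vs ! 1} \<noteq> {vs ! 2, vs ! k}"
      "{vs ! 1, vs ! 2} \<noteq> {vs ! 2, vs ! k}"
    using ne by (metis doubleton_eq_iff)+
  then have "card {{vs ! 0, vs ! 1}, {vs ! 1, vs ! 2}, {vs ! 2, vs ! k}} = 3" by simp
  moreover have "{{vs ! 0, vs ! 1}, {vs ! 1, vs ! 2}, {vs ! 2, vs ! k}} \<subseteq> F" using edges by simp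
  ultimately show ?thesis using card_mono[OF assms(2)] by metis
qed

text \<open>The first three edges of a cycle have no common vertex.\<close>

lemma no_cycle_in_star: "\<not> is_cycle {{b, r} |b. b < r} vs" for r :: nat
proof
  let ?F = "{{b, r} |b. b < r}"
  assume cyc: "is_cycle ?F vs"
  then have len: "3 \<le> length vs" and dist: "distinct vs"
    and edge: "\<And>i. i < length vs \<Longrightarrow> {vs ! i, vs ! (Suc i mod length vs)} \<in> ?F"
    unfolding is_cycle_def by auto
  have "vs \<noteq> []" using len by auto
  define k where "k = 3 mod length vs"
  have k: "k < length vs" "k \<noteq> 1" "k \<noteq> 2"
    using len unfolding k_def by (cases "length vs = 3"; simp)+
  have eq: "vs ! i \<noteq> vs ! j" if "i < length vs" "j < length vs" "i \<noteq> j" for i j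
    using that dist nth_eq_iff_index_eq by blast
  have ne: "vs ! 0 \<noteq> vs ! 1" "vs ! 0 \<noteq> vs ! 2" "vs ! 1 \<noteq> vs ! 2" "vs ! 1 \<noteq> vs ! k" "vs ! 2 \<noteq> vs ! k"
    using k len \<open>vs \<noteq> []\<close> by (intro eq; simp)+
  have root: "r \<in> e" if "e \<in> ?F" for e using that by auto
  have "r \<in> {vs ! 0, vs ! 1}" "r \<in> {vs ! 1, vs ! 2}" "r \<in> {vs ! 2, vs ! k}"
    using root[OF edge[of 0]] root[OF edge[of 1]] root[OF edge[of 2]] len \<open>vs \<noteq> []\<close> unfolding k_def
    by (simp_all add: numeral_2_eq_2 numeral_3_eq_3)
  then show False using ne by blast
qed

lemma triangle_is_cycle:
  assumes "x \<noteq> y" "y \<noteq> z" "z \<noteq> x"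
  shows "is_cycle {{x, y}, {y, z}, {z, x}} [x, y, z]"
  unfolding is_cycle_def
proof (intro conjI allI impI)
  fix i assume "i < length [x, y, z]"
  then consider "i = 0" | "i = 1" | "i = 2" by fastforce
  then show "{[x, y, z] ! i, [x, y, z] ! (Suc i mod length [x, y, z])} \<in> {{x, y}, {y, z}, {z, x}}"
    by cases simp_all
qed (use assms in simp_all)


section \<open>Uniqueness of the representation of a complete graph\<close>

lemma sum_single: "(\<Sum>b<r. (if b = k then c else 0) * W b) = (if k < r then c * W k else 0)"
  for r k :: nat and c :: real
proof -
  have "(\<Sum>b<r. (if b = k then c else 0) * W b) = (\<Sum>b<r. if b = k then c * W k else 0)"
    by (intro sum.cong) auto
  then show ?thesis by simp
qed

text \<open>The edges at the vertex \<open>r\<close> form a basis. Every other edge \<open>xy\<close> is a combination of \<open>xr\<close> and \<open>yr\<close>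
  with nonzero coefficients, because triangles are dependent and pairs of edges are not. The factors
  \<open>sg\<close> are chosen so that the edges at the vertex 0 become multiples of differences, and then the
  triangle \<open>0xy\<close> forces the same for the edge \<open>xy\<close>.\<close>

lemma complete_graph_representation_unique:
  fixes w :: "nat \<Rightarrow> nat \<Rightarrow> nat \<Rightarrow> real" and r m :: nat
  assumes sym: "\<And>x y. w x y = w y x"
    and star: "\<And>a. \<forall>i<m. (\<Sum>b<r. a b * w b r i) = 0 \<Longrightarrow> \<forall>b<r. a b = 0"
    and pair: "\<And>x y x' y' p q. x \<le> r \<Longrightarrow> y \<le> r \<Longrightarrow> x' \<le> r \<Longrightarrow> y' \<le> r \<Longrightarrow> x \<noteq> y \<Longrightarrow> x' \<noteq> y' \<Longrightarrow>
        {x, y} \<noteq> {x', y'} \<Longrightarrow> \<forall>i<m. p * w x y i + q * w x' y' i = 0 \<Longrightarrow> p = 0 \<and> q = 0"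
    and triangle: "\<And>x y z. x \<le> r \<Longrightarrow> y \<le> r \<Longrightarrow> z \<le> r \<Longrightarrow> x \<noteq> y \<Longrightarrow> y \<noteq> z \<Longrightarrow> z \<noteq> x \<Longrightarrow>
        \<exists>p q s. (p \<noteq> 0 \<or> q \<noteq> 0 \<or> s \<noteq> 0) \<and> (\<forall>i<m. p * w x y i + q * w y z i + s * w z x i = 0)"
  shows "\<exists>sg ell. (\<forall>b<r. sg b \<noteq> 0) \<and> (\<forall>x\<le>r. \<forall>y\<le>r. x \<noteq> y \<longrightarrow> ell x y \<noteq> 0 \<and>
    (\<forall>i<m. w x y i = ell x y * ((if x < r then sg x * w x r i else 0) - (if y < r then sg y * w y r i else 0))))"
proof -
  have step: "\<exists>al be. al \<noteq> 0 \<and> be \<noteq> 0 \<and> (\<forall>i<m. w x y i = al * w x r i + be * w y r i)"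
    if xy: "x < r" "y < r" "x \<noteq> y" for x y
  proof -
    have "\<exists>p q s. (p \<noteq> 0 \<or> q \<noteq> 0 \<or> s \<noteq> 0) \<and> (\<forall>i<m. p * w x y i + q * w y r i + s * w r x i = 0)"
      by (rule triangle) (use xy in auto)
    then obtain p q s where nz: "p \<noteq> 0 \<or> q \<noteq> 0 \<or> s \<noteq> 0" and rel: "\<forall>i<m. p * w x y i + q * w y r i + s * w r x i = 0" by blast
    have p: "p \<noteq> 0"
    proof
      assume "p = 0"
      then have "\<forall>i<m. q * w y r i + s * w r x i = 0" using rel by simp
      then have "q = 0 \<and> s = 0"
        by (rule pair[rotated -1]) (use xy in \<open>auto simp: doubleton_eq_iff\<close>)
      then show False using nz \<open>p = 0\<close> by simp
    qed
    have s: "s \<noteq> 0"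
    proof
      assume "s = 0"
      then have "\<forall>i<m. p * w x y i + q * w y r i = 0" using rel by simp
      then have "p = 0 \<and> q = 0"
        by (rule pair[rotated -1]) (use xy in \<open>auto simp: doubleton_eq_iff\<close>)
      then show False using p by simp
    qed
    have q: "q \<noteq> 0"
    proof
      assume "q = 0"
      then have "\<forall>i<m. p * w x y i + s * w r x i = 0" using rel by simp
      then have "p = 0 \<and> s = 0"
        by (rule pair[rotated -1]) (use xy in \<open>auto simp: doubleton_eq_iff\<close>)
      then show False using p by simp
    qed
    have comb: "w x y i = - (s / p) * w x r i + - (q / p) * w y r i" if "i < m" for i
    proof -
      have "p * w x y i + q * w y r i + s * w x r i = 0" using rel that sym[of r x] by simp
      then have "p * w x y i = - (s * w x r i) - q * w y r i" by linarith
      then have "w x y i = (- (s * w x r i) - q * w y r i) / p" using p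
        by (metis nonzero_mult_div_cancel_left)
      then show ?thesis by (simp add: diff_divide_distrib)
    qed
    show ?thesis
    proof (rule exI[of _ "- (s / p)"], rule exI[of _ "- (q / p)"], intro conjI allI impI)
      show "- (s / p) \<noteq> 0" "- (q / p) \<noteq> 0" using p q s by simp_all
      show "w x y i = - (s / p) * w x r i + - (q / p) * w y r i" if "i < m" for i by (rule comb[OF that])
    qed
  qed
  define al where "al x y = (SOME a. \<exists>b. a \<noteq> 0 \<and> b \<noteq> 0 \<and> (\<forall>i<m. w x y i = a * w x r i + b * w y r i))" for x y
  define be where "be x y = (SOME b. al x y \<noteq> 0 \<and> b \<noteq> 0 \<and> (\<forall>i<m. w x y i = al x y * w x r i + b * w y r i))" for x y
  have ab: "al x y \<noteq> 0 \<and> be x y \<noteq> 0 \<and> (\<forall>i<m. w x y i = al x y * w x r i + be x y * w y r i)"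
    if "x < r" "y < r" "x \<noteq> y" for x y
  proof -
    have "\<exists>b. al x y \<noteq> 0 \<and> b \<noteq> 0 \<and> (\<forall>i<m. w x y i = al x y * w x r i + b * w y r i)"
      unfolding al_def by (rule someI_ex) (rule step[OF that])
    then show ?thesis unfolding be_def by (rule someI_ex)
  qed
  have ab_nz: "al x y \<noteq> 0" "be x y \<noteq> 0" if "x < r" "y < r" "x \<noteq> y" for x y
    using ab[OF that] by blast+
  define sg where "sg b = (if b = 0 then 1 else - be 0 b / al 0 b)" for b
  have sg0: "sg 0 = 1" unfolding sg_def by simp
  define U where "U b i = (if b < r then sg b * w b r i else 0)" for b i
  have sg: "sg b \<noteq> 0" if "b < r" for b
  proof (cases "b = 0")
    case True
    show ?thesis unfolding True sg0 by (rule one_neq_zero)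
  next
    case False
    have "0 < r" "0 \<noteq> b" using that False by simp_all
    note nz = ab_nz[OF this(1) that this(2)]
    show ?thesis unfolding sg_def if_not_P[OF False] using nz by simp
  qed
  define P where "P x y \<longleftrightarrow> (\<exists>l. l \<noteq> 0 \<and> (\<forall>i<m. w x y i = l * (U x i - U y i)))" for x y
  have P_I: "P x y" if "l \<noteq> 0" "\<And>i. i < m \<Longrightarrow> w x y i = l * (U x i - U y i)" for x y l
    unfolding P_def by (rule exI[of _ l], rule conjI[OF that(1)], intro allI impI, rule that(2))
  have P_E: "\<exists>l. l \<noteq> 0 \<and> (\<forall>i<m. w x y i = l * (U x i - U y i))" if "P x y" for x y
    using that by (simp only: P_def)
  have P_sym: "P y x" if Pxy: "P x y" for x y
  proof -
    obtain l where l: "l \<noteq> 0" "\<And>i. i < m \<Longrightarrow> w x y i = l * (U x i - U y i)" using P_E[OF Pxy] by metis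
    have "w y x i = - l * (U y i - U x i)" if "i < m" for i
    proof -
      have "w x y i = l * (U x i - U y i)" using that by (rule l(2))
      then show ?thesis unfolding sym[of y x] by (simp add: algebra_simps)
    qed
    moreover have "- l \<noteq> 0" using l(1) by simp
    ultimately show ?thesis by (rule P_I[rotated])
  qed
  have P_root: "P x r" if "x < r" for x
  proof -
    have "w x r i = 1 / sg x * (U x i - U r i)" if "i < m" for i
      unfolding U_def using sg[OF \<open>x < r\<close>] \<open>x < r\<close> by simp
    moreover have "1 / sg x \<noteq> 0" using sg[OF that] by simp
    ultimately show ?thesis by (rule P_I[rotated])
  qed
  have P_zero: "P 0 y" if "y < r" "y \<noteq> 0" for y
  proof -
    have "0 < r" using that by simp
    moreover have "0 \<noteq> y" using that by simp
    ultimately have "al 0 y \<noteq> 0 \<and> be 0 y \<noteq> 0 \<and> (\<forall>i<m. w 0 y i = al 0 y * w 0 r i + be 0 y * w y r i)"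
      using that by (intro ab)
    then have nz: "al 0 y \<noteq> 0" and eq: "\<forall>i<m. w 0 y i = al 0 y * w 0 r i + be 0 y * w y r i" by blast+
    have "w 0 y i = al 0 y * (U 0 i - U y i)" if i: "i < m" for i
    proof -
      have "w 0 y i = al 0 y * w 0 r i + be 0 y * w y r i" using eq i by blast
      also have "\<dots> = al 0 y * (U 0 i - U y i)"
        unfolding U_def sg_def using nz \<open>0 < r\<close> \<open>y < r\<close> \<open>y \<noteq> 0\<close> by (simp add: algebra_simps)
      finally show ?thesis .
    qed
    with nz show ?thesis by (rule P_I)
  qed
  have P_inner: "P x y" if xy: "x < r" "y < r" "x \<noteq> y" "x \<noteq> 0" "y \<noteq> 0" for x y
  proof -
    have r: "0 < r" using xy by simp
    obtain l where l: "l \<noteq> 0" "\<And>i. i < m \<Longrightarrow> w 0 x i = l * (U 0 i - U x i)"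
      using P_E[OF P_zero[OF xy(1,4)]] by metis
    obtain l' where l': "l' \<noteq> 0" "\<And>i. i < m \<Longrightarrow> w 0 y i = l' * (U 0 i - U y i)"
      using P_E[OF P_zero[OF xy(2,5)]] by metis
    have "\<exists>p q s. (p \<noteq> 0 \<or> q \<noteq> 0 \<or> s \<noteq> 0) \<and> (\<forall>i<m. p * w 0 x i + q * w x y i + s * w y 0 i = 0)"
      by (rule triangle) (use xy in auto)
    then obtain p q s where nz: "p \<noteq> 0 \<or> q \<noteq> 0 \<or> s \<noteq> 0" and rel: "\<forall>i<m. p * w 0 x i + q * w x y i + s * w y 0 i = 0" by blast
    have q: "q \<noteq> 0"
    proof
      assume "q = 0"
      then have "\<forall>i<m. p * w 0 x i + s * w y 0 i = 0" using rel by simp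
      then have "p = 0 \<and> s = 0"
        by (rule pair[rotated -1]) (use xy in \<open>auto simp: doubleton_eq_iff\<close>)
      then show False using nz \<open>q = 0\<close> by simp
    qed
    have p: "p \<noteq> 0"
    proof
      assume "p = 0"
      then have "\<forall>i<m. q * w x y i + s * w y 0 i = 0" using rel by simp
      then have "q = 0 \<and> s = 0"
        by (rule pair[rotated -1]) (use xy in \<open>auto simp: doubleton_eq_iff\<close>)
      then show False using q by simp
    qed
    have abxy: "\<forall>i<m. w x y i = al x y * w x r i + be x y * w y r i" using ab[OF xy(1,2,3)] by blast
    define a where "a b = (if b = 0 then p * l + s * l' else 0) +
      ((if b = x then q * al x y - p * l * sg x else 0) + (if b = y then q * be x y - s * l' * sg y else 0))" for b
    have "(\<Sum>b<r. a b * w b r i) = 0" if i: "i < m" for i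
    proof -
      have "(\<Sum>b<r. a b * w b r i) = (p * l + s * l') * w 0 r i +
          ((q * al x y - p * l * sg x) * w x r i + (q * be x y - s * l' * sg y) * w y r i)"
        unfolding a_def distrib_right sum.distrib sum_single using xy r by simp
      also have "\<dots> = p * w 0 x i + q * w x y i + s * w y 0 i"
      proof -
        have w: "w 0 x i = l * (w 0 r i - sg x * w x r i)" "w y 0 i = l' * (w 0 r i - sg y * w y r i)"
          "w x y i = al x y * w x r i + be x y * w y r i"
          using l(2)[OF i] l'(2)[OF i] abxy[THEN spec[of _ i]] i xy r sg0 unfolding U_def sym[of y 0] by simp_all
        show ?thesis unfolding w by (simp add: algebra_simps)
      qed
      finally show ?thesis using rel i by simp
    qed
    then have "\<forall>b<r. a b = 0" by (intro star) blast
    then have "a 0 = 0" using r by blast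
    then have rel0: "s * l' = - (p * l)" using xy unfolding a_def by simp
    have "w x y i = p * l / q * (U x i - U y i)" if i: "i < m" for i
    proof -
      have "p * (l * (U 0 i - U x i)) + q * w x y i + s * (l' * (U 0 i - U y i)) = 0"
        using rel[THEN spec[of _ i]] i unfolding l(2)[OF i] l'(2)[OF i] sym[of y 0] by simp
      then have "q * w x y i = - (p * l * (U 0 i - U x i)) - s * l' * (U 0 i - U y i)" by (simp add: mult.assoc)
      also have "\<dots> = p * l * (U x i - U y i)" unfolding rel0 by (simp add: algebra_simps)
      finally have "w x y i = p * l * (U x i - U y i) / q" using q
        by (metis nonzero_mult_div_cancel_left)
      then show ?thesis by simp
    qed
    moreover have "p * l / q \<noteq> 0" using p q l(1) by simp
    ultimately show ?thesis by (rule P_I[rotated])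
  qed
  have P: "P x y" if "x \<le> r" "y \<le> r" "x \<noteq> y" for x y
  proof (cases "x = r \<or> y = r")
    case True
    then show ?thesis
    proof
      assume "x = r"
      then show ?thesis using P_sym[OF P_root[of y]] that by simp
    next
      assume "y = r"
      then show ?thesis using P_root[of x] that by simp
    qed
  next
    case False
    then have lt: "x < r" "y < r" using that by auto
    show ?thesis
    proof (cases "x = 0 \<or> y = 0")
      case True
      then show ?thesis
      proof
        assume "x = 0"
        then show ?thesis using P_zero[of y] that lt by simp
      next
        assume "y = 0"
        then show ?thesis using P_sym[OF P_zero[of x]] that lt by simp
      qed
    next
      case False
      then show ?thesis using P_inner[OF lt that(3)] by simp
    qed
  qed
  define ell where "ell x y = (SOME l. l \<noteq> 0 \<and> (\<forall>i<m. w x y i = l * (U x i - U y i)))" for x y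
  have "ell x y \<noteq> 0 \<and> (\<forall>i<m. w x y i = ell x y * (U x i - U y i))" if "x \<le> r" "y \<le> r" "x \<noteq> y" for x y
    unfolding ell_def by (rule someI_ex[OF P_E[OF P[OF that]]])
  then show ?thesis using sg unfolding U_def by blast
qed

section \<open>Matroids represented by integer matrices\<close>

locale represented_matroid = matroid M for M :: "'a set_system" +
  fixes A :: "int mat" and f :: "'a \<Rightarrow> nat" and \<Delta> :: nat
  assumes f_bij: "bij_betw f (ground M) {..<dim_col A}"
    and f_rank: "\<And>S. S \<subseteq> ground M \<Longrightarrow> rank_of M S = real_rank (submatrix A UNIV (f ` S))"
    and modular: "modular_matrix \<Delta> A"
begin

definition entry :: "'a \<Rightarrow> nat \<Rightarrow> real" where
  "entry x i = real_of_int (A $$ (i, f x))"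

lemma f_inj: "inj_on f (ground M)"
  using f_bij by (rule bij_betw_imp_inj_on)

lemma f_image: "S \<subseteq> ground M \<Longrightarrow> f ` S \<subseteq> {..<dim_col A}"
  using f_bij bij_betw_imp_surj_on by blast

lemma sum_columns:
  assumes "S \<subseteq> ground M"
  shows "(\<Sum>j\<in>f ` S. a j * real_of_int (A $$ (i, j))) = (\<Sum>x\<in>S. a (f x) * entry x i)"
  unfolding entry_def using sum.reindex[OF inj_on_subset[OF f_inj assms]] by simp

definition finv :: "nat \<Rightarrow> 'a" where "finv = inv_into (ground M) f"

lemma finv_f: "x \<in> ground M \<Longrightarrow> finv (f x) = x"
  unfolding finv_def using f_inj by (rule inv_into_f_f)

lemma indep_iff:
  assumes S: "S \<subseteq> ground M"
  shows "S \<in> indep M \<longleftrightarrow>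
    (\<forall>a. (\<forall>i<dim_row A. (\<Sum>x\<in>S. a x * entry x i) = 0) \<longrightarrow> (\<forall>x\<in>S. a x = 0))"
proof -
  have card: "card (f ` S) = card S" using card_image[OF inj_on_subset[OF f_inj S]] .
  have "S \<in> indep M \<longleftrightarrow> real_rank (submatrix A UNIV (f ` S)) = card (f ` S)"
    using rank_of_eq_card_iff[OF S] f_rank[OF S] card by simp
  also have "\<dots> \<longleftrightarrow> (\<forall>a. (\<forall>i<dim_row A. (\<Sum>x\<in>S. a (f x) * entry x i) = 0) \<longrightarrow> (\<forall>j\<in>f ` S. a j = 0))"
    unfolding real_rank_full_iff[OF f_image[OF S]] sum_columns[OF S] ..
  also have "\<dots> \<longleftrightarrow> (\<forall>a. (\<forall>i<dim_row A. (\<Sum>x\<in>S. a x * entry x i) = 0) \<longrightarrow> (\<forall>x\<in>S. a x = 0))"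
  proof (intro iffI allI impI ballI)
    fix a x
    assume free: "\<forall>a. (\<forall>i<dim_row A. (\<Sum>x\<in>S. a (f x) * entry x i) = 0) \<longrightarrow> (\<forall>j\<in>f ` S. a j = 0)"
      and rel: "\<forall>i<dim_row A. (\<Sum>x\<in>S. a x * entry x i) = 0" and x: "x \<in> S"
    have inv: "finv (f y) = y" if "y \<in> S" for y using finv_f that S by blast
    have eq: "(\<Sum>y\<in>S. a (finv (f y)) * entry y i) = (\<Sum>y\<in>S. a y * entry y i)" for i
      by (intro sum.cong refl) (simp add: inv)
    have "\<forall>i<dim_row A. (\<Sum>y\<in>S. a (finv (f y)) * entry y i) = 0" unfolding eq by (rule rel)
    then have "\<forall>j\<in>f ` S. a (finv j) = 0" by (rule mp[OF free[THEN spec[of _ "\<lambda>j. a (finv j)"]]])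
    then have "a (finv (f x)) = 0" using x by blast
    then show "a x = 0" unfolding inv[OF x] .
  next
    fix a j
    assume free: "\<forall>a. (\<forall>i<dim_row A. (\<Sum>x\<in>S. a x * entry x i) = 0) \<longrightarrow> (\<forall>x\<in>S. a x = 0)"
      and rel: "\<forall>i<dim_row A. (\<Sum>x\<in>S. a (f x) * entry x i) = 0" and j: "j \<in> f ` S"
    have "\<forall>x\<in>S. a (f x) = 0" by (rule mp[OF free[THEN spec[of _ "\<lambda>x. a (f x)"]] rel])
    then show "a j = 0" using j by blast
  qed
  finally show ?thesis .
qed

lemma indepD:
  assumes "S \<in> indep M" "\<And>i. i < dim_row A \<Longrightarrow> (\<Sum>x\<in>S. a x * entry x i) = 0" "x \<in> S"
  shows "a x = 0"
proof -
  have all: "\<forall>a. (\<forall>i<dim_row A. (\<Sum>x\<in>S. a x * entry x i) = 0) \<longrightarrow> (\<forall>x\<in>S. a x = 0)"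
    using indep_iff[OF indep_subset[OF assms(1)]] assms(1) by (rule iffD1)
  have "\<forall>x\<in>S. a x = 0" by (rule mp[OF spec[OF all, of a]]) (intro allI impI assms(2))
  then show ?thesis using assms(3) by blast
qed

lemma not_indep_relation:
  assumes "S \<subseteq> ground M" "S \<notin> indep M"
  shows "\<exists>a. (\<forall>i<dim_row A. (\<Sum>x\<in>S. a x * entry x i) = 0) \<and> (\<exists>x\<in>S. a x \<noteq> 0)"
proof (rule ccontr)
  assume none: "\<not> ?thesis"
  have "\<forall>a. (\<forall>i<dim_row A. (\<Sum>x\<in>S. a x * entry x i) = 0) \<longrightarrow> (\<forall>x\<in>S. a x = 0)"
  proof (intro allI impI ballI, rule ccontr)
    fix a x assume "\<forall>i<dim_row A. (\<Sum>x\<in>S. a x * entry x i) = 0" "x \<in> S" "a x \<noteq> 0"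
    then show False using none by blast
  qed
  then show False using indep_iff[OF assms(1)] assms(2) by simp
qed

lemma spans_of_combination:
  assumes Y: "Y \<subseteq> ground M" and t: "t \<in> ground M"
    and comb: "\<And>i. i < dim_row A \<Longrightarrow> entry t i = (\<Sum>y\<in>Y. c y * entry y i)"
  shows "spans M Y t"
proof -
  have inv: "finv (f y) = y" if "y \<in> Y" for y using finv_f that Y by blast
  have tY: "insert t Y \<subseteq> ground M" using Y t by simp
  have "real_rank (submatrix A UNIV (insert (f t) (f ` Y))) = real_rank (submatrix A UNIV (f ` Y))"
  proof (rule real_rank_cong_span[where c = "\<lambda>j. c (finv j)"])
    show "insert (f t) (f ` Y) \<subseteq> {..<dim_col A}" using f_image[OF tY] by simp
    fix i assume i: "i < dim_row A"
    have "(\<Sum>j\<in>f ` Y. c (finv j) * real_of_int (A $$ (i, j))) = (\<Sum>y\<in>Y. c (finv (f y)) * entry y i)"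
      by (rule sum_columns[OF Y])
    also have "\<dots> = (\<Sum>y\<in>Y. c y * entry y i)" by (intro sum.cong refl) (simp add: inv)
    finally show "real_of_int (A $$ (i, f t)) = (\<Sum>j\<in>f ` Y. c (finv j) * real_of_int (A $$ (i, j)))"
      using comb[OF i] unfolding entry_def by simp
  qed
  then show ?thesis unfolding spans_def f_rank[OF Y] f_rank[OF tY] by simp
qed

lemma real_rank_eq: "real_rank A = matroid_rank M"
proof -
  have cols: "{j. j < dim_col A \<and> j \<in> {..<dim_col A}} = {..<dim_col A}" by auto
  have "submatrix A UNIV {..<dim_col A} = A"
  proof (rule eq_matI)
    fix i j assume ij: "i < dim_row A" "j < dim_col A"
    have "pick {..<dim_col A} j = j"
      using pick_reduce_set[of j "dim_col A" UNIV] ij by (simp add: pick_UNIV lessThan_def)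
    then show "submatrix A UNIV {..<dim_col A} $$ (i, j) = A $$ (i, j)"
      using ij by (subst submatrix_index) (simp_all add: pick_UNIV)
  qed (simp_all add: dim_submatrix)
  then show ?thesis
    unfolding matroid_rank_def f_rank[OF order_refl] bij_betw_imp_surj_on[OF f_bij] by simp
qed

text \<open>The elements may be repeated, in which case the determinant vanishes.\<close>

lemma minor_bound:
  assumes rows: "distinct rs" "length rs = matroid_rank M" "set rs \<subseteq> {..<dim_row A}"
    and xs: "length xs = matroid_rank M" "set xs \<subseteq> ground M"
  shows "\<bar>det (mat (matroid_rank M) (matroid_rank M) (\<lambda>(a, b). A $$ (rs ! a, f (xs ! b))))\<bar> \<le> int \<Delta>"
proof -
  define k where "k = matroid_rank M"
  define Z where "Z = mat k k (\<lambda>(a, b). A $$ (rs ! a, f (xs ! b)))"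
  have Z: "Z \<in> carrier_mat k k" unfolding Z_def by simp
  have "\<bar>det Z\<bar> \<le> int \<Delta>"
  proof (cases "distinct (map f xs)")
    case False
    then obtain i j where ij: "i < k" "j < k" "i \<noteq> j" "map f xs ! i = map f xs ! j"
      using xs(1) unfolding distinct_conv_nth k_def by auto
    have "f (xs ! i) = f (xs ! j)" using ij xs(1) unfolding k_def by simp
    then have "col Z i = col Z j" using ij unfolding Z_def by (intro eq_vecI) simp_all
    then have "det Z = 0" by (rule det_identical_columns[OF Z ij(3,1,2)])
    then show ?thesis by simp
  next
    case True
    have js: "length (map f xs) = k" "set (map f xs) \<subseteq> {..<dim_col A}"
      using xs f_image[OF xs(2)] unfolding k_def by simp_all
    have "mat k k (\<lambda>(a, b). A $$ (rs ! a, map f xs ! b)) = Z"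
      unfolding Z_def by (rule eq_matI) (use js in simp_all)
    then have "\<bar>det Z\<bar> = \<bar>det (submatrix A (set rs) (set (map f xs)))\<bar>"
      using det_submatrix_lists[OF rows(1) rows(2)[folded k_def] rows(3) True js] by simp
    also have "\<dots> \<le> int \<Delta>"
    proof -
      have c: "card (set rs) = real_rank A" "card (set (map f xs)) = real_rank A"
        using distinct_card[OF rows(1)] distinct_card[OF True] rows(2) xs(1) real_rank_eq by simp_all
      show ?thesis
        by (rule modular[unfolded modular_matrix_def, rule_format, OF rows(3) js(2) c])
    qed
    finally show ?thesis .
  qed
  then show ?thesis unfolding Z_def k_def .
qed

end

section \<open>A spanning clique in a represented matroid\<close>

locale clique_in_matroid = represented_matroid M A f \<Delta>
  for M :: "'a set_system" and A f \<Delta> +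
  fixes X :: "'a set" and g :: "'a \<Rightarrow> nat set" and r :: nat
  assumes rank_r: "matroid_rank M = r"
    and X_sub: "X \<subseteq> ground M"
    and g_bij: "bij_betw g X (complete_graph (r + 1))"
    and g_indep: "\<And>I. I \<subseteq> X \<Longrightarrow> I \<in> indep M \<longleftrightarrow> g ` I \<in> indep (graphic_matroid (complete_graph (r + 1)))"
begin

definition el :: "nat \<Rightarrow> nat \<Rightarrow> 'a" where
  "el x y = inv_into X g {x, y}"

lemma edge_complete: "x \<le> r \<Longrightarrow> y \<le> r \<Longrightarrow> x \<noteq> y \<Longrightarrow> {x, y} \<in> complete_graph (r + 1)"
  unfolding complete_graph_def by auto

lemma el_in: "x \<le> r \<Longrightarrow> y \<le> r \<Longrightarrow> x \<noteq> y \<Longrightarrow> el x y \<in> X"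
  unfolding el_def using edge_complete g_bij by (metis bij_betw_imp_surj_on inv_into_into)

lemma g_el: "x \<le> r \<Longrightarrow> y \<le> r \<Longrightarrow> x \<noteq> y \<Longrightarrow> g (el x y) = {x, y}"
  unfolding el_def using edge_complete g_bij by (metis bij_betw_imp_surj_on f_inv_into_f)

lemma el_sym: "el x y = el y x"
  unfolding el_def by (simp add: insert_commute)

lemma indep_iff_acyclic:
  assumes "I \<subseteq> X"
  shows "I \<in> indep M \<longleftrightarrow> \<not> (\<exists>vs. is_cycle (g ` I) vs)"
proof -
  have "g ` I \<subseteq> complete_graph (r + 1)" using assms g_bij bij_betw_imp_surj_on by blast
  then show ?thesis unfolding g_indep[OF assms] graphic_matroid_def by simp
qed

definition star :: "'a set" where "star = (\<lambda>b. el b r) ` {..<r}"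

lemma star_inj: "inj_on (\<lambda>b. el b r) {..<r}"
proof (rule inj_onI)
  fix b b' assume b: "b \<in> {..<r}" "b' \<in> {..<r}" "el b r = el b' r"
  then have "{b, r} = {b', r}" using g_el[of b r] g_el[of b' r] by simp
  then show "b = b'" by (auto simp: doubleton_eq_iff)
qed

lemma star_sub: "star \<subseteq> X"
  unfolding star_def using el_in by auto

lemma star_indep: "star \<in> indep M"
proof -
  have "g ` star = {{b, r} |b. b < r}"
    unfolding star_def image_image using g_el by (auto simp: image_iff)
  then show ?thesis using indep_iff_acyclic[OF star_sub] no_cycle_in_star by simp
qed

lemma card_star: "card star = r"
  unfolding star_def using card_image[OF star_inj] by simp

lemma sum_star: "(\<Sum>x\<in>star. h x) = (\<Sum>b<r. h (el b r))"
  unfolding star_def by (simp add: sum.reindex[OF star_inj])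

lemma small_indep:
  assumes "I \<subseteq> X" "card I \<le> 2" "finite I"
  shows "I \<in> indep M"
proof -
  have "card (g ` I) \<le> 2" using card_image_le[OF assms(3), of g] assms(2) by simp
  then have "\<not> is_cycle (g ` I) vs" for vs
    using three_le_card_cycle[of "g ` I" vs] assms(3) by auto
  then show ?thesis using indep_iff_acyclic[OF assms(1)] by simp
qed

definition w :: "nat \<Rightarrow> nat \<Rightarrow> nat \<Rightarrow> real" where "w x y i = entry (el x y) i"

lemma w_sym: "w x y = w y x"
  unfolding w_def[abs_def] using el_sym[of x y] by simp

lemma w_star:
  assumes "\<forall>i<dim_row A. (\<Sum>b<r. a b * w b r i) = 0"
  shows "\<forall>b<r. a b = 0"
proof (intro allI impI)
  fix b assume b: "b < r"
  define a' where "a' x = a (inv_into {..<r} (\<lambda>b. el b r) x)" for x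
  have a': "a' (el b r) = a b" if "b < r" for b
    unfolding a'_def using inv_into_f_f[OF star_inj, of b] that by simp
  have "(\<Sum>x\<in>star. a' x * entry x i) = 0" if i: "i < dim_row A" for i
  proof -
    have "(\<Sum>x\<in>star. a' x * entry x i) = (\<Sum>b<r. a b * w b r i)"
      unfolding sum_star w_def by (intro sum.cong refl) (simp add: a')
    then show ?thesis using assms i by simp
  qed
  then have "a' (el b r) = 0"
    by (rule indepD[OF star_indep]) (use b in \<open>auto simp: star_def\<close>)
  then show "a b = 0" using a'[OF b] by simp
qed

lemma w_pair:
  assumes xy: "x \<le> r" "y \<le> r" "x' \<le> r" "y' \<le> r" "x \<noteq> y" "x' \<noteq> y'" "{x, y} \<noteq> {x', y'}"
    and rel: "\<forall>i<dim_row A. p * w x y i + q * w x' y' i = 0"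
  shows "p = 0 \<and> q = 0"
proof -
  let ?e = "el x y" and ?e' = "el x' y'"
  have ne: "?e \<noteq> ?e'" using g_el[OF xy(1,2,5)] g_el[OF xy(3,4,6)] xy(7) by metis
  have ind: "{?e, ?e'} \<in> indep M"
    by (rule small_indep) (use el_in xy ne in simp_all)
  define a where "a x = (if x = ?e then p else q)" for x
  have sum: "(\<Sum>x\<in>{?e, ?e'}. a x * entry x i) = 0" if "i < dim_row A" for i
    using rel[THEN spec[of _ i]] that ne unfolding a_def w_def by simp
  have "a ?e = 0" by (rule indepD[OF ind sum]) simp_all
  moreover have "a ?e' = 0" by (rule indepD[OF ind sum]) simp_all
  ultimately show ?thesis using ne unfolding a_def by simp
qed

lemma w_triangle:
  assumes xyz: "x \<le> r" "y \<le> r" "z \<le> r" "x \<noteq> y" "y \<noteq> z" "z \<noteq> x"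
  shows "\<exists>p q s. (p \<noteq> 0 \<or> q \<noteq> 0 \<or> s \<noteq> 0) \<and>
    (\<forall>i<dim_row A. p * w x y i + q * w y z i + s * w z x i = 0)"
proof -
  let ?S = "{el x y, el y z, el z x}"
  have g: "g (el x y) = {x, y}" "g (el y z) = {y, z}" "g (el z x) = {z, x}"
    using g_el xyz by simp_all
  have "{x, y} \<noteq> {y, z}" "{y, z} \<noteq> {z, x}" "{z, x} \<noteq> {x, y}"
    using xyz by (auto simp: doubleton_eq_iff)
  then have ne: "el x y \<noteq> el y z" "el y z \<noteq> el z x" "el z x \<noteq> el x y" using g by metis+
  have S: "?S \<subseteq> X" using el_in xyz by simp
  have "g ` ?S = {{x, y}, {y, z}, {z, x}}" using g by simp
  then have "?S \<notin> indep M"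
    using indep_iff_acyclic[OF S] triangle_is_cycle[OF xyz(4,5,6)] by auto
  moreover have "?S \<subseteq> ground M" using S X_sub by blast
  ultimately obtain a where a: "\<forall>i<dim_row A. (\<Sum>x\<in>?S. a x * entry x i) = 0" "\<exists>x\<in>?S. a x \<noteq> 0"
    using not_indep_relation[of ?S] by blast
  have "(\<Sum>x\<in>?S. a x * entry x i) = a (el x y) * w x y i + a (el y z) * w y z i + a (el z x) * w z x i" for i
    using ne not_sym[OF ne(3)] unfolding w_def by simp
  then have "\<forall>i<dim_row A. a (el x y) * w x y i + a (el y z) * w y z i + a (el z x) * w z x i = 0"
    using a(1) by simp
  moreover have "a (el x y) \<noteq> 0 \<or> a (el y z) \<noteq> 0 \<or> a (el z x) \<noteq> 0" using a(2) by simp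
  ultimately show ?thesis by blast
qed

end

text \<open>The factors \<open>sg\<close> and \<open>ell\<close> are those of \<open>complete_graph_representation_unique\<close>.\<close>

locale coordinates = clique_in_matroid M A f \<Delta> X g r
  for M :: "'a set_system" and A f \<Delta> X g r +
  fixes sg :: "nat \<Rightarrow> real" and ell :: "nat \<Rightarrow> nat \<Rightarrow> real"
  assumes sg: "\<And>b. b < r \<Longrightarrow> sg b \<noteq> 0"
    and ell: "\<And>x y. x \<le> r \<Longrightarrow> y \<le> r \<Longrightarrow> x \<noteq> y \<Longrightarrow> ell x y \<noteq> 0"
    and w_eq: "\<And>x y i. x \<le> r \<Longrightarrow> y \<le> r \<Longrightarrow> x \<noteq> y \<Longrightarrow> i < dim_row A \<Longrightarrow>
      w x y i = ell x y * ((if x < r then sg x * w x r i else 0) - (if y < r then sg y * w y r i else 0))"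
begin

text \<open>The image of the unit vector at the vertex \<open>b\<close>. The vertex \<open>r\<close> is mapped to zero, which loses nothing
  on vectors with sum zero.\<close>

definition U :: "nat \<Rightarrow> nat \<Rightarrow> real" where "U b i = (if b < r then sg b * w b r i else 0)"

definition val :: "(nat \<Rightarrow> real) \<Rightarrow> nat \<Rightarrow> real" where "val d i = (\<Sum>b<r. d b * U b i)"

lemma U_indep:
  assumes "\<forall>i<dim_row A. (\<Sum>b<r. a b * U b i) = 0"
  shows "\<forall>b<r. a b = 0"
proof -
  have "(\<Sum>b<r. a b * U b i) = (\<Sum>b<r. (a b * sg b) * w b r i)" for i
    by (intro sum.cong refl) (simp add: U_def)
  then have "\<forall>b<r. a b * sg b = 0" using assms by (intro w_star) simp
  then show ?thesis using sg by simp
qed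

lemma val_edge: "val (edge_vec x y) i = U x i - U y i"
proof -
  have "val (edge_vec x y) i = (\<Sum>b<r. (if b = x then 1 else 0) * U b i) - (\<Sum>b<r. (if b = y then 1 else 0) * U b i)"
    unfolding val_def edge_vec_def left_diff_distrib sum_subtractf ..
  then show ?thesis unfolding sum_single by (simp add: U_def)
qed

lemma val_add: "val (\<lambda>u. d u + c * d' u) i = val d i + c * val d' i"
  unfolding val_def by (simp add: distrib_right sum.distrib sum_distrib_left mult.assoc)

lemma val_scale: "val (\<lambda>u. c * d u) i = c * val d i"
  unfolding val_def by (simp add: sum_distrib_left mult.assoc)

lemma entry_el:
  assumes "x \<le> r" "y \<le> r" "x \<noteq> y" "i < dim_row A"
  shows "entry (el x y) i = ell x y * val (edge_vec x y) i"
  unfolding val_edge U_def using w_eq[OF assms] unfolding w_def by simp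

lemma ell_sym:
  assumes "x \<le> r" "y \<le> r"
  shows "\<bar>ell x y\<bar> = \<bar>ell y x\<bar>"
proof (cases "x = y")
  case False
  have "{el x y} \<in> indep M" by (rule small_indep) (use el_in assms False in simp_all)
  have nonzero: "\<exists>i<dim_row A. entry (el x y) i \<noteq> 0"
  proof (rule ccontr)
    assume none: "\<not> ?thesis"
    have sum: "(\<Sum>e\<in>{el x y}. 1 * entry e i) = 0" if "i < dim_row A" for i using none that by simp
    have "(1 :: real) = 0"
      by (rule indepD[OF \<open>{el x y} \<in> indep M\<close> sum singletonI])
    then show False by simp
  qed
  then obtain i where i: "i < dim_row A" "entry (el x y) i \<noteq> 0" by blast
  have e: "entry (el x y) i = ell x y * (U x i - U y i)"
    using entry_el[OF assms False i(1)] unfolding val_edge .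
  moreover have "entry (el x y) i = ell y x * (U y i - U x i)"
    using entry_el[OF assms(2,1) not_sym[OF False] i(1)] unfolding val_edge el_sym[of y x] .
  ultimately have "(ell x y + ell y x) * (U x i - U y i) = 0" by (simp add: algebra_simps)
  moreover have "U x i - U y i \<noteq> 0" using e i(2) by auto
  ultimately have "ell x y = - ell y x" by simp
  then show ?thesis by simp
qed simp

lemma columns_of_edge_span:
  assumes "edge_span {..r} k d"
  shows "\<exists>Y c. Y \<subseteq> X \<and> finite Y \<and> card Y \<le> k \<and> (\<forall>i<dim_row A. val d i = (\<Sum>e\<in>Y. c e * entry e i))"
  using assms
proof (induction rule: edge_span.induct)
  case (zero k)
  show ?case by (rule exI[of _ "{}"]) (simp add: val_def)
next
  case (step k d x y a)
  obtain Y c where Y: "Y \<subseteq> X" "finite Y" "card Y \<le> k" "\<forall>i<dim_row A. val d i = (\<Sum>e\<in>Y. c e * entry e i)"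
    using step.IH by blast
  show ?case
  proof (cases "x = y")
    case True
    have "(\<lambda>u. d u + a * edge_vec x y u) = d" unfolding True edge_vec_def by simp
    then show ?thesis using Y by (intro exI[of _ Y] exI[of _ c]) simp
  next
    case False
    have xy: "x \<le> r" "y \<le> r" using step.hyps by simp_all
    define e0 where "e0 = el x y"
    define c' where "c' e = (if e \<in> Y then c e else 0) + (if e = e0 then a / ell x y else 0)" for e
    have "val (\<lambda>u. d u + a * edge_vec x y u) i = (\<Sum>e\<in>insert e0 Y. c' e * entry e i)" if i: "i < dim_row A" for i
    proof -
      have "(\<Sum>e\<in>insert e0 Y. c' e * entry e i) = (\<Sum>e\<in>insert e0 Y. (if e \<in> Y then c e * entry e i else 0))
          + (\<Sum>e\<in>insert e0 Y. (if e = e0 then a / ell x y * entry e i else 0))"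
        unfolding c'_def sum.distrib[symmetric] by (intro sum.cong refl) (simp add: distrib_right)
      also have "(\<Sum>e\<in>insert e0 Y. (if e = e0 then a / ell x y * entry e i else 0)) = a / ell x y * entry e0 i"
        using Y(2) by simp
      also have "(\<Sum>e\<in>insert e0 Y. (if e \<in> Y then c e * entry e i else 0)) = (\<Sum>e\<in>Y. c e * entry e i)"
        using Y(2) by (subst sum.inter_restrict[symmetric]) (simp_all add: Int_absorb1 subset_insertI)
      also have "\<dots> = val d i" using Y(4) i by simp
      also have "a / ell x y * entry e0 i = a * val (edge_vec x y) i"
        unfolding e0_def entry_el[OF xy False i] using ell[OF xy False] by simp
      finally show ?thesis unfolding val_add ..
    qed
    moreover have "insert e0 Y \<subseteq> X" using Y(1) el_in[OF xy False] unfolding e0_def by simp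
    moreover have "card (insert e0 Y) \<le> Suc k" using Y(2,3) by (simp add: card_insert_if)
    ultimately show ?thesis using Y(2) by (intro exI[of _ "insert e0 Y"] exI[of _ c']) simp
  qed
qed

text \<open>The star at \<open>r\<close> is a basis, which determines the entries of \<open>v\<close> at the vertices below \<open>r\<close>. The entry
  at \<open>r\<close> does not matter for \<open>val\<close> and is used to make the sum zero.\<close>

lemma coordinate_vector:
  assumes t: "t \<in> ground M"
  shows "\<exists>v. sum v {..r} = 0 \<and> (\<forall>u. u \<notin> {..r} \<longrightarrow> v u = 0) \<and> (\<forall>i<dim_row A. entry t i = val v i)"
proof -
  have "\<exists>k. \<forall>i<dim_row A. entry t i = val k i"
  proof (cases "t \<in> star")
    case True
    then obtain b where b: "b < r" "t = el b r" unfolding star_def by auto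
    have "entry t i = val (\<lambda>u. ell b r * edge_vec b r u) i" if "i < dim_row A" for i
      unfolding b(2) val_scale using entry_el[of b r i] b(1) that by simp
    then show ?thesis by blast
  next
    case False
    have star_ground: "star \<subseteq> ground M" using star_sub X_sub by blast
    have fin: "finite star" unfolding star_def by simp
    have "card (insert t star) = Suc r" using False fin card_star by simp
    then have "insert t star \<notin> indep M" using card_indep_le_rank[of "insert t star"] rank_r by auto
    moreover have "insert t star \<subseteq> ground M" using star_ground t by simp
    ultimately obtain a where a: "\<forall>i<dim_row A. (\<Sum>x\<in>insert t star. a x * entry x i) = 0" "\<exists>x\<in>insert t star. a x \<noteq> 0"
        using not_indep_relation[of "insert t star"] by blast
    have split: "(\<Sum>x\<in>insert t star. a x * entry x i) = a t * entry t i + (\<Sum>x\<in>star. a x * entry x i)" for i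
      using False fin by simp
    have at: "a t \<noteq> 0"
    proof
      assume z: "a t = 0"
      have rel: "(\<Sum>x\<in>star. a x * entry x i) = 0" if "i < dim_row A" for i
        using a(1) that unfolding split z by simp
      have "a x = 0" if "x \<in> star" for x by (rule indepD[OF star_indep rel that])
      then have "\<forall>x\<in>insert t star. a x = 0" using z by simp
      then show False using a(2) by blast
    qed
    define k where "k b = - a (el b r) / (a t * sg b)" for b
    have "entry t i = val k i" if i: "i < dim_row A" for i
    proof -
      have "val k i = (\<Sum>b<r. - (1 / a t) * (a (el b r) * entry (el b r) i))"
        unfolding val_def
      proof (intro sum.cong refl)
        fix b assume "b \<in> {..<r}"
        then have "b < r" by simp
        then show "k b * U b i = - (1 / a t) * (a (el b r) * entry (el b r) i)"
          unfolding k_def U_def w_def using sg[of b] by simp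
      qed
      also have "\<dots> = - (1 / a t) * (\<Sum>x\<in>star. a x * entry x i)"
        unfolding sum_star sum_distrib_left ..
      also have "(\<Sum>x\<in>star. a x * entry x i) = - (a t * entry t i)"
        using a(1) i unfolding split by (simp add: add_eq_0_iff2)
      finally show ?thesis using at by simp
    qed
    then show ?thesis by blast
  qed
  then obtain k where k: "\<forall>i<dim_row A. entry t i = val k i" by blast
  define v where "v u = (if u < r then k u else if u = r then - (\<Sum>b<r. k b) else 0)" for u
  have "sum v {..r} = 0"
    unfolding lessThan_Suc_atMost[symmetric] sum.lessThan_Suc by (simp add: v_def)
  moreover have "v u = 0" if "u \<notin> {..r}" for u using that unfolding v_def by simp
  moreover have "entry t i = val v i" if "i < dim_row A" for i
  proof -
    have "val v i = val k i" unfolding val_def by (intro sum.cong refl) (simp add: v_def)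
    then show ?thesis using k that by simp
  qed
  ultimately show ?thesis by blast
qed

text \<open>The minor of \<open>A\<close> is the product of a fixed minor \<open>D\<close>, which belongs to the basis \<open>U\<close>, and the
  determinant of the coordinate vectors.\<close>

lemma row_det_entries:
  assumes rs: "length rs = r" and len: "length xs = r" "length es = r"
    and rs_sub: "set rs \<subseteq> {..<dim_row A}"
    and eq: "\<And>c i. c < r \<Longrightarrow> i < dim_row A \<Longrightarrow> entry (es ! c) i = val (xs ! c) i"
  shows "row_det r (map (\<lambda>i b. U b i) rs) * row_det r xs
    = real_of_int (det (mat r r (\<lambda>(a, c). A $$ (rs ! a, f (es ! c)))))"
proof -
  define P where "P = mat r r (\<lambda>(a, b). (map (\<lambda>i b. U b i) rs ! a) b)"
  define Q where "Q = mat r r (\<lambda>(i, j). (xs ! i) j)"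
  define Z where "Z = mat r r (\<lambda>(a, c). A $$ (rs ! a, f (es ! c)))"
  have P: "P \<in> carrier_mat r r" and Q: "Q \<in> carrier_mat r r" unfolding P_def Q_def by simp_all
  have "P * Q\<^sup>T = map_mat real_of_int Z"
  proof (rule eq_matI)
    fix a c assume "a < dim_row (map_mat real_of_int Z)" "c < dim_col (map_mat real_of_int Z)"
    then have ac: "a < r" "c < r" unfolding Z_def by simp_all
    have "rs ! a \<in> set rs" using ac rs by simp
    then have ra: "rs ! a < dim_row A" using rs_sub by blast
    have "(P * Q\<^sup>T) $$ (a, c) = (\<Sum>b<r. U b (rs ! a) * (xs ! c) b)"
      using ac rs unfolding P_def Q_def by (simp add: scalar_prod_def atLeast0LessThan)
    also have "\<dots> = val (xs ! c) (rs ! a)" unfolding val_def by (simp add: mult.commute)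
    also have "\<dots> = entry (es ! c) (rs ! a)" using eq[OF ac(2) ra] by simp
    finally show "(P * Q\<^sup>T) $$ (a, c) = map_mat real_of_int Z $$ (a, c)"
      using ac unfolding Z_def entry_def by simp
  qed (simp_all add: P_def Q_def Z_def)
  then have "det P * det (Q\<^sup>T) = det (map_mat real_of_int Z)"
    using det_mult[OF P, of "Q\<^sup>T"] Q by simp
  then show ?thesis
    unfolding row_det_def P_def[symmetric] Q_def[symmetric] Z_def[symmetric] det_transpose[OF Q]
    by simp
qed

lemma edge_span_coordinates:
  assumes t: "t \<in> ground M"
    and v: "sum v {..r} = 0" "\<And>u. u \<notin> {..r} \<Longrightarrow> v u = 0" "\<And>i. i < dim_row A \<Longrightarrow> entry t i = val v i"
  shows "edge_span {..r} \<Delta> v"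
proof -
  obtain rs where rs: "length rs = r" "set rs \<subseteq> {..<dim_row A}" "row_det r (map (\<lambda>i b. U b i) rs) \<noteq> 0"
    by (rule nonzero_minor[where m = "dim_row A" and r = r and B = "\<lambda>i b. U b i", OF U_indep])
  define D where "D = row_det r (map (\<lambda>i b. U b i) rs)"
  have dist: "distinct rs"
  proof (rule ccontr)
    assume "\<not> distinct rs"
    then obtain i j where ij: "i < r" "j < r" "i \<noteq> j" "rs ! i = rs ! j"
      using rs(1) unfolding distinct_conv_nth by auto
    then have "row_det r (map (\<lambda>i b. U b i) rs) = 0"
      by (intro row_det_repeat[of _ _ i j]) (use rs(1) in simp_all)
    then show False using rs(3) by simp
  qed
  define good where "good x e \<longleftrightarrow> e \<in> ground M \<and> (\<forall>i<dim_row A. entry e i = val x i)" for x e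
  show ?thesis
  proof (rule edge_span_of_minors)
    show "D \<noteq> 0" unfolding D_def by (rule rs(3))
    show "ell x y \<noteq> 0" if "x \<in> {..r}" "y \<in> {..r}" "x \<noteq> y" for x y using ell that by simp
    show "\<bar>ell x y\<bar> = \<bar>ell y x\<bar>" if "x \<in> {..r}" "y \<in> {..r}" for x y using ell_sym that by simp
    show "sum v {..r} = 0" by (rule v(1))
    show "v u = 0" if "u \<notin> {..r}" for u using that by (rule v(2))
    fix xs :: "(nat \<Rightarrow> real) list"
    assume len: "length xs = r"
      and xs: "\<And>x. x \<in> set xs \<Longrightarrow> x = v \<or> (\<exists>p\<in>{..r}. \<exists>q\<in>{..r}. p \<noteq> q \<and> x = (\<lambda>u. ell p q * edge_vec p q u))"
    have ex: "\<exists>e. good x e" if x: "x \<in> set xs" for x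
      using xs[OF x]
    proof
      assume "x = v"
      then have "good x t" unfolding good_def using t v(3) by simp
      then show ?thesis by blast
    next
      assume "\<exists>p\<in>{..r}. \<exists>q\<in>{..r}. p \<noteq> q \<and> x = (\<lambda>u. ell p q * edge_vec p q u)"
      then obtain p q where pq: "p \<le> r" "q \<le> r" "p \<noteq> q" "x = (\<lambda>u. ell p q * edge_vec p q u)" by auto
      have "entry (el p q) i = val x i" if "i < dim_row A" for i
        unfolding pq(4) val_scale using entry_el[OF pq(1,2,3) that] .
      moreover have "el p q \<in> ground M" using el_in[OF pq(1,2,3)] X_sub by blast
      ultimately show ?thesis unfolding good_def by blast
    qed
    define es where "es = map (\<lambda>x. SOME e. good x e) xs"
    have good: "good (xs ! c) (es ! c)" if "c < r" for c
    proof -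
      have "xs ! c \<in> set xs" using that len by simp
      then have "good (xs ! c) (SOME e. good (xs ! c) e)" by (rule someI_ex[OF ex])
      then show ?thesis unfolding es_def using that len by simp
    qed
    have len_es: "length es = r" unfolding es_def using len by simp
    have es_ground: "set es \<subseteq> ground M"
    proof
      fix e assume "e \<in> set es"
      then obtain c where "c < r" "e = es ! c" unfolding in_set_conv_nth len_es by blast
      then show "e \<in> ground M" using good[of c] unfolding good_def by simp
    qed
    have "row_det (Suc r) (xs @ [unit_fun r]) = row_det r xs" by (rule row_det_last_unit[OF len])
    moreover have "D * row_det r xs = real_of_int (det (mat r r (\<lambda>(a, c). A $$ (rs ! a, f (es ! c)))))"
      unfolding D_def by (rule row_det_entries[OF rs(1) len len_es rs(2)]) (use good in \<open>simp add: good_def\<close>)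
    ultimately have eq: "D * row_det (Suc r) (xs @ [unit_fun r])
        = real_of_int (det (mat r r (\<lambda>(a, c). A $$ (rs ! a, f (es ! c)))))" by simp
    have "\<bar>det (mat r r (\<lambda>(a, c). A $$ (rs ! a, f (es ! c))))\<bar> \<le> int \<Delta>"
      using minor_bound[of rs es] dist rs(1,2) len_es es_ground unfolding rank_r by simp
    then have "\<bar>real_of_int (det (mat r r (\<lambda>(a, c). A $$ (rs ! a, f (es ! c)))))\<bar> \<le> real \<Delta>"
      by (metis of_int_abs of_int_le_iff of_int_of_nat_eq)
    then show "D * row_det (Suc r) (xs @ [unit_fun r]) \<in> \<int> \<and> \<bar>D * row_det (Suc r) (xs @ [unit_fun r])\<bar> \<le> real \<Delta>"
      unfolding eq by simp
  qed
qed

lemma spanned_by_few: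
  assumes t: "t \<in> ground M"
  shows "\<exists>Y\<subseteq>X. card Y \<le> \<Delta> \<and> spans M Y t"
proof -
  obtain v where v: "sum v {..r} = 0" "\<forall>u. u \<notin> {..r} \<longrightarrow> v u = 0" "\<forall>i<dim_row A. entry t i = val v i"
    using coordinate_vector[OF t] by blast
  have "edge_span {..r} \<Delta> v" by (rule edge_span_coordinates[OF t v(1)]) (simp_all add: v(2,3))
  obtain Y c where Y: "Y \<subseteq> X" "card Y \<le> \<Delta>" "\<forall>i<dim_row A. val v i = (\<Sum>e\<in>Y. c e * entry e i)"
    using columns_of_edge_span[OF \<open>edge_span {..r} \<Delta> v\<close>] by blast
  have "spans M Y t"
  proof (rule spans_of_combination[OF _ t])
    show "Y \<subseteq> ground M" using Y(1) X_sub by blast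
    show "entry t i = (\<Sum>e\<in>Y. c e * entry e i)" if "i < dim_row A" for i using v(3) Y(3) that by simp
  qed
  then show ?thesis using Y(1,2) by blast
qed

end

theorem proposition2p3:
  fixes \<Delta> r :: nat and M :: "'a set_system" and X :: "'a set"
  assumes "\<Delta> > 0"
    and "M \<in> modular_matroids \<Delta>"
    and "matroid_rank M = r"
    and "X \<subseteq> ground M"
    and "restriction M X \<simeq>\<^sub>M graphic_matroid (complete_graph (r + 1))"
  shows "\<forall>t \<in> ground M. \<exists>Y \<subseteq> X. card Y \<le> \<Delta> \<and> spans M Y t"
proof -
  obtain A where A: "matroid M" "modular_matrix \<Delta> A" "represents A M"
    using assms(2) unfolding modular_matroids_def by blast
  obtain f where f: "bij_betw f (ground M) {..<dim_col A}"
    "\<forall>S\<subseteq>ground M. rank_of M S = real_rank (submatrix A UNIV (f ` S))"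
    using A(3) unfolding represents_def by blast
  obtain g where g: "bij_betw g X (complete_graph (r + 1))"
    "\<forall>I\<subseteq>X. I \<in> indep M \<longleftrightarrow> g ` I \<in> indep (graphic_matroid (complete_graph (r + 1)))"
  proof -
    obtain g where "bij_betw g (ground (restriction M X)) (ground (graphic_matroid (complete_graph (r + 1))))"
      "\<forall>I\<subseteq>ground (restriction M X). I \<in> indep (restriction M X) \<longleftrightarrow>
        g ` I \<in> indep (graphic_matroid (complete_graph (r + 1)))"
      using assms(5) unfolding matroid_iso_def by (elim exE conjE)
    then show ?thesis using that[of g] by (simp add: restriction_def graphic_matroid_def)
  qed
  interpret matroid M by (rule A(1))
  interpret clique_in_matroid M A f \<Delta> X g r
  proof unfold_locales
    show "rank_of M S = real_rank (submatrix A UNIV (f ` S))" if "S \<subseteq> ground M" for S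
      using f(2) that by blast
    show "I \<in> indep M \<longleftrightarrow> g ` I \<in> indep (graphic_matroid (complete_graph (r + 1)))" if "I \<subseteq> X" for I
      using g(2) that by blast
  qed (fact A(2) f(1) g(1) assms(3,4))+
  have "\<exists>sg ell. (\<forall>b<r. sg b \<noteq> 0) \<and> (\<forall>x\<le>r. \<forall>y\<le>r. x \<noteq> y \<longrightarrow> ell x y \<noteq> 0 \<and>
    (\<forall>i<dim_row A. w x y i = ell x y * ((if x < r then sg x * w x r i else 0) - (if y < r then sg y * w y r i else 0))))"
    by (rule complete_graph_representation_unique[where w = w and r = r and m = "dim_row A"])
      (fact w_sym w_star w_pair w_triangle)+
  then obtain sg ell where se: "\<forall>b<r. sg b \<noteq> 0"
    "\<forall>x\<le>r. \<forall>y\<le>r. x \<noteq> y \<longrightarrow> ell x y \<noteq> 0 \<and>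
    (\<forall>i<dim_row A. w x y i = ell x y * ((if x < r then sg x * w x r i else 0) - (if y < r then sg y * w y r i else 0)))"
    by (elim exE conjE)
  interpret coordinates M A f \<Delta> X g r sg ell
  proof unfold_locales
    show "sg b \<noteq> 0" if "b < r" for b using se(1) that by blast
    fix x y assume xy: "x \<le> r" "y \<le> r" "x \<noteq> y"
    have s: "ell x y \<noteq> 0 \<and> (\<forall>i<dim_row A. w x y i =
        ell x y * ((if x < r then sg x * w x r i else 0) - (if y < r then sg y * w y r i else 0)))"
      using se(2) xy by blast
    show "ell x y \<noteq> 0" by (rule conjunct1[OF s])
    show "w x y i = ell x y * ((if x < r then sg x * w x r i else 0) - (if y < r then sg y * w y r i else 0))"
      if "i < dim_row A" for i
      using conjunct2[OF s] that by blast
  qed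
  show ?thesis using spanned_by_few by blast
qed

end
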